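(* Let $n\ge1$, $s\in(0,1)$, let $\Omega\subset\mathbb R^n$ be a bounded open set with Lipschitz boundary, and let $f\ge0$, $f\in L^{\frac n\sigma}(\Omega)$ for some $\sigma\in(0,s)$, be such that there exist $r_o>0$ and $x_o\in\Omega$ with $B_{r_o}(x_o)\subset\Omega$ and $\int_{B_{r_o}(x_o)}f\,dx>0$. (1) If $h_s^f(\Omega)>1$, then the null function is the unique minimizer of $\mathcal F_1^s$. (2) If $h_s^f(\Omega)=1$, then there exists a non-negative minimizer of $\mathcal F_1^s$. (3) If $h_s^f(\Omega)<1$, then $\displaystyle\inf_{u\in\mathcal W_0^{s,1}(\Omega)}\mathcal F_1^s(u)=-\infty$.
   Context: $\mathcal W^{s,1}_0(\Omega)$ is the closure of $C_c^\infty(\Omega)$ in the norm $\|u\|_{W^{s,1}(\Omega)}=\|u\|_{L^1(\Omega)}+\int_\Omega\int_\Omega\frac{|u(x)-u(y)|}{|x-y|^{n+s}}dxdy$, its elements being functions on $\mathbb R^n$ vanishing on $\mathbb R^n\setminus\Omega$ (for Lipschitz bounded $\Omega$ it equals the set of all $u:\mathbb R^n\to\mathbb R$ with $u=0$ on $\mathbb R^n\setminus\Omega$ and finite norm). $\mathcal F_1^s(u)=\frac12\iint_{\mathbb R^{2n}}\frac{|u(x)-u(y)|}{|x-y|^{n+s}}dxdy-\int_\Omega fu\,dx$. A minimizer of $\mathcal F_1^s$ is a $u\in\mathcal W_0^{s,1}(\Omega)$ with $\mathcal F_1^s(u)\le\mathcal F_1^s(v)$ for all $v\in\mathcal W_0^{s,1}(\Omega)$.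 $\operatorname{Per}_s(A)=\frac12\iint_{\mathbb R^{2n}}\frac{|\chi_A(x)-\chi_A(y)|}{|x-y|^{n+s}}dxdy$, $|A|_f=\int_Af\,dx$, and the $(s,f)$-Cheeger constant is $h_s^f(\Omega)=\inf\left\{\frac{\operatorname{Per}_s(A)}{|A|_f}\,:\,A\subset\Omega \text{ measurable},\ |A|_f>0\right\}$. *)

theory Defs
  imports "HOL-Analysis.Analysis"
begin

text \<open>
  Throughout, \<open>\<real>\<^sup>n\<close> is a type \<open>'a\<close> of class \<open>euclidean_space\<close> with \<open>n = DIM('a)\<close>.
  Functions are Lebesgue measurable representatives of their a.e. classes.
\<close>

text \<open>Near each boundary point, \<open>\<Omega>\<close> is the strict epigraph of a Lipschitz function over a
  hyperplane, in the direction of its unit normal \<open>e\<close> (that is, after a rotation of the axes).\<close>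

definition lipschitz_boundary :: "'a::euclidean_space set \<Rightarrow> bool" where
  "lipschitz_boundary \<Omega> \<longleftrightarrow>
     (\<forall>p\<in>frontier \<Omega>. \<exists>e r L. \<exists>g :: 'a \<Rightarrow> real.
        norm e = 1 \<and> 0 < r \<and> L-lipschitz_on {y. y \<bullet> e = 0} g \<and>
        (\<forall>x\<in>ball p r. x \<in> \<Omega> \<longleftrightarrow> g (x - (x \<bullet> e) *\<^sub>R e) < x \<bullet> e))"

definition in_Lp :: "real \<Rightarrow> 'a::euclidean_space set \<Rightarrow> ('a \<Rightarrow> real) \<Rightarrow> bool" where
  "in_Lp p \<Omega> f \<longleftrightarrow>
     set_borel_measurable lebesgue \<Omega> f \<and> set_integrable lebesgue \<Omega> (\<lambda>x. \<bar>f x\<bar> powr p)"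

primrec C_k :: "nat \<Rightarrow> ('a::euclidean_space \<Rightarrow> real) \<Rightarrow> bool" where
  "C_k 0 \<phi> \<longleftrightarrow> continuous_on UNIV \<phi>"
| "C_k (Suc k) \<phi> \<longleftrightarrow>
     (\<forall>x. \<phi> differentiable (at x)) \<and>
     (\<forall>i\<in>Basis. C_k k (\<lambda>x. frechet_derivative \<phi> (at x) i))"

definition Cc_infinity :: "'a::euclidean_space set \<Rightarrow> ('a \<Rightarrow> real) set" where
  "Cc_infinity \<Omega> =
     {\<phi>. (\<forall>k. C_k k \<phi>) \<and> compact (closure {x. \<phi> x \<noteq> 0}) \<and> closure {x. \<phi> x \<noteq> 0} \<subseteq> \<Omega>}"

text \<open>On the diagonal the integrand is \<open>0 / 0 = 0\<close>.\<close>

definition gagliardo :: "real \<Rightarrow> 'a::euclidean_space set \<Rightarrow> ('a \<Rightarrow> real) \<Rightarrow> ennreal" where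
  "gagliardo s E u =
     (\<integral>\<^sup>+x\<in>E. (\<integral>\<^sup>+y\<in>E. ennreal (\<bar>u x - u y\<bar> / norm (x - y) powr (real DIM('a) + s)) \<partial>lebesgue) \<partial>lebesgue)"

definition Ws1_norm :: "real \<Rightarrow> 'a::euclidean_space set \<Rightarrow> ('a \<Rightarrow> real) \<Rightarrow> ennreal" where
  "Ws1_norm s \<Omega> u = (\<integral>\<^sup>+x\<in>\<Omega>. ennreal \<bar>u x\<bar> \<partial>lebesgue) + gagliardo s \<Omega> u"

definition Ws1_0 :: "real \<Rightarrow> 'a::euclidean_space set \<Rightarrow> ('a \<Rightarrow> real) set" where
  "Ws1_0 s \<Omega> =
     {u. u \<in> borel_measurable lebesgue \<and> (\<forall>x. x \<notin> \<Omega> \<longrightarrow> u x = 0) \<and>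
         (\<exists>\<phi>. (\<forall>k. \<phi> k \<in> Cc_infinity \<Omega>) \<and>
              (\<lambda>k. Ws1_norm s \<Omega> (\<lambda>x. u x - \<phi> k x)) \<longlonglongrightarrow> 0)}"

text \<open>The value is an extended real, so that no finiteness of the double integral is presupposed.
  For bounded Lipschitz \<open>\<Omega>\<close>, \<open>f \<in> L\<^bsup>n/\<sigma>\<^esup>(\<Omega>)\<close> with \<open>\<sigma> < s\<close>, and \<open>u\<close> in \<open>Ws1_0 s \<Omega>\<close>, the product
  \<open>f u\<close> is integrable by the fractional Sobolev embedding.\<close>

definition F1 :: "real \<Rightarrow> ('a::euclidean_space \<Rightarrow> real) \<Rightarrow> 'a set \<Rightarrow> ('a \<Rightarrow> real) \<Rightarrow> ereal" where
  "F1 s f \<Omega> u =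
     enn2ereal (1/2 * gagliardo s UNIV u) - ereal (LINT x:\<Omega>|lebesgue. f x * u x)"

definition is_minimizer ::
    "real \<Rightarrow> ('a::euclidean_space \<Rightarrow> real) \<Rightarrow> 'a set \<Rightarrow> ('a \<Rightarrow> real) \<Rightarrow> bool" where
  "is_minimizer s f \<Omega> u \<longleftrightarrow> u \<in> Ws1_0 s \<Omega> \<and> (\<forall>v\<in>Ws1_0 s \<Omega>. F1 s f \<Omega> u \<le> F1 s f \<Omega> v)"

definition Per :: "real \<Rightarrow> 'a::euclidean_space set \<Rightarrow> ennreal" where
  "Per s A = 1/2 * gagliardo s UNIV (indicator A)"

definition weighted_volume :: "('a::euclidean_space \<Rightarrow> real) \<Rightarrow> 'a set \<Rightarrow> real" where
  "weighted_volume f A = (LINT x:A|lebesgue. f x)"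

definition cheeger :: "real \<Rightarrow> ('a::euclidean_space \<Rightarrow> real) \<Rightarrow> 'a set \<Rightarrow> ennreal" where
  "cheeger s f \<Omega> =
     (INF A\<in>{A. A \<subseteq> \<Omega> \<and> A \<in> sets lebesgue \<and> 0 < weighted_volume f A}.
        Per s A / ennreal (weighted_volume f A))"

end

theory Submission
  imports Defs
begin

text \<open>
  Everything rests on the coarea formula: half the Gagliardo seminorm of \<open>u\<close> is the integral of the
  fractional perimeters of its superlevel sets. Integrating the isoperimetric inequality
  \<open>h * |A|\<^sub>f \<le> Per\<^sub>s A\<close> over the superlevel sets of \<open>\<bar>u\<bar>\<close> gives the functional Cheeger inequality
  \<open>h * \<integral> f \<bar>u\<bar> \<le> 1/2 [u]\<close> (\<open>functional_cheeger_inequality\<close>), where \<open>h\<close> is the Cheeger constant and \<open>[u]\<close>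
  the seminorm over the whole space.

  If \<open>h \<ge> 1\<close>, the functional is therefore nonnegative, and the null function, whose energy is zero, is a
  nonnegative minimizer (\<open>F1_nonneg\<close>). If \<open>h > 1\<close>, a function of energy at most zero has zero seminorm;
  it is then almost everywhere constant, and the constant is zero because it vanishes off a bounded set
  (\<open>minimizer_AE_zero\<close>).

  If \<open>h < 1\<close>, some \<open>A \<subseteq> \<Omega>\<close> has \<open>Per\<^sub>s A < |A|\<^sub>f\<close>, so its indicator has negative energy, and by homogeneity
  multiples of a competitor with negative energy drive the functional to \<open>-\<infinity>\<close>. The
  indicator must be replaced by a test function without losing the strict inequality. First it is
  multiplied by a cutoff \<open>\<eta>\<^sub>k\<close> that vanishes near the boundary. The additional seminorm is an integral of
  increments \<open>\<bar>\<eta>\<^sub>k x - \<eta>\<^sub>k y\<bar>\<close> against the kernel over \<open>A \<times> A\<close>, and these increments are bounded,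
  independently of \<open>k\<close>, by a quantity whose integral in \<open>x\<close> is at most a multiple of \<open>d y powr (- s)\<close>, where \<open>d\<close> is
  the distance to the complement of \<open>\<Omega>\<close>. Since \<open>\<Omega>\<close> is Lipschitz, its complement contains balls of comparable size
  next to every boundary point, so \<open>d y powr (- s)\<close> is bounded by a multiple of the interaction of \<open>y\<close> with the
  complement of \<open>\<Omega>\<close> (\<open>kernel_of_complement_ge\<close>). Integrated over \<open>A\<close> this is at most a multiple of the finite
  perimeter of \<open>A\<close>, and dominated convergence shows that the error vanishes (\<open>cutoff_error_tendsto_0\<close>). The
  cut-off function is then mollified. This does not increase the seminorm, which is convex and
  translation invariant, and it converges in \<open>L\<^sup>1\<close> at the rate \<open>\<epsilon> powr s\<close> (\<open>smooth_approximation\<close>).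
\<close>

section \<open>The Gagliardo seminorm over the whole space\<close>

text \<open>The singular kernel of the fractional perimeter. It takes the value \<open>0\<close> at the origin, because
  \<open>1 / 0 = 0\<close>; the singularity itself is never integrated.\<close>
definition frac_kernel :: "real \<Rightarrow> 'a::euclidean_space \<Rightarrow> ennreal" where
  "frac_kernel s z = ennreal (1 / norm z powr (real DIM('a) + s))"

lemma frac_kernel_measurable [measurable]: "frac_kernel s \<in> borel_measurable borel"
  unfolding frac_kernel_def by measurable

lemma frac_kernel_minus: "frac_kernel s (x - y) = frac_kernel s (y - x)"
  by (simp add: frac_kernel_def norm_minus_commute)

lemma frac_kernel_pos: "z \<noteq> 0 \<Longrightarrow> 0 < frac_kernel s z"
  by (simp add: frac_kernel_def)

text \<open>The completion of a measure has the same nonnegative integral, so every estimate below can be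
  made for Borel functions and Lebesgue--Borel measure, where measurability in several variables
  is stable under translations.\<close>
lemma gagliardo_UNIV:
  fixes u :: "'a::euclidean_space \<Rightarrow> real"
  shows "gagliardo s UNIV u =
    (\<integral>\<^sup>+x. (\<integral>\<^sup>+y. ennreal \<bar>u x - u y\<bar> * frac_kernel s (x - y) \<partial>lborel) \<partial>lborel)"
  unfolding gagliardo_def frac_kernel_def nn_integral_completion
  by (simp add: ennreal_mult'[symmetric])

lemma gagliardo_cong_AE:
  fixes u v :: "'a::euclidean_space \<Rightarrow> real"
  assumes "AE x in lborel. u x = v x"
  shows "gagliardo s UNIV u = gagliardo s UNIV v"
  unfolding gagliardo_UNIV
proof (rule nn_integral_cong_AE)
  show "AE x in lborel. (\<integral>\<^sup>+y. ennreal \<bar>u x - u y\<bar> * frac_kernel s (x - y) \<partial>lborel) =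
                        (\<integral>\<^sup>+y. ennreal \<bar>v x - v y\<bar> * frac_kernel s (x - y) \<partial>lborel)"
    using assms
  proof eventually_elim
    case (elim x)
    show ?case using assms by (intro nn_integral_cong_AE) (auto simp: elim)
  qed
qed

lemma gagliardo_cmult:
  fixes u :: "'a::euclidean_space \<Rightarrow> real"
  assumes [measurable]: "u \<in> borel_measurable borel"
  shows "gagliardo s UNIV (\<lambda>x. c * u x) = ennreal \<bar>c\<bar> * gagliardo s UNIV u"
proof -
  have "ennreal \<bar>c * u x - c * u y\<bar> = ennreal \<bar>c\<bar> * ennreal \<bar>u x - u y\<bar>" for x y
    by (simp add: ennreal_mult'[symmetric] abs_mult[symmetric] right_diff_distrib)
  then show ?thesis
    unfolding gagliardo_UNIV by (simp add: mult.assoc nn_integral_cmult)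
qed

lemma gagliardo_mono:
  fixes u v :: "'a::euclidean_space \<Rightarrow> real"
  assumes "\<And>x y. \<bar>u x - u y\<bar> \<le> \<bar>v x - v y\<bar>"
  shows "gagliardo s UNIV u \<le> gagliardo s UNIV v"
  unfolding gagliardo_UNIV
  by (intro nn_integral_mono mult_right_mono ennreal_leI assms) auto

section \<open>Coarea formula and functional Cheeger inequality\<close>

text \<open>A level \<open>t\<close> separates \<open>a\<close> from \<open>b\<close> exactly when it lies in the half-open interval between them,
  whose length is \<open>\<bar>a - b\<bar>\<close>.\<close>
lemma abs_diff_eq_nn_integral_levels:
  fixes a b :: real
  shows "ennreal \<bar>a - b\<bar> = (\<integral>\<^sup>+t. ennreal \<bar>of_bool (t < a) - of_bool (t < b)\<bar> \<partial>lborel)"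
proof -
  have "(\<integral>\<^sup>+t. ennreal \<bar>of_bool (t < a) - of_bool (t < b)\<bar> \<partial>lborel)
      = (\<integral>\<^sup>+t. indicator {min a b..<max a b} t \<partial>lborel)"
    by (intro nn_integral_cong) (auto simp: indicator_def)
  then show ?thesis by (simp add: max_def min_def)
qed

text \<open>Writing \<open>\<bar>u x - u y\<bar>\<close> as an integral over the levels that separate \<open>u x\<close> from \<open>u y\<close> turns the
  seminorm into a triple integral; Tonelli moves the integration over levels to the outside.\<close>
lemma coarea_formula:
  fixes u :: "'a::euclidean_space \<Rightarrow> real"
  assumes [measurable]: "u \<in> borel_measurable borel"
  shows "gagliardo s UNIV u = (\<integral>\<^sup>+t. gagliardo s UNIV (indicator {x. t < u x}) \<partial>lborel)"
proof -
  let ?D = "\<lambda>t x y. ennreal \<bar>of_bool (t < u x) - of_bool (t < u y)\<bar>"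
  have "gagliardo s UNIV u =
      (\<integral>\<^sup>+x. \<integral>\<^sup>+y. \<integral>\<^sup>+t. ?D t x y * frac_kernel s (x - y) \<partial>lborel \<partial>lborel \<partial>lborel)"
    unfolding gagliardo_UNIV abs_diff_eq_nn_integral_levels[of "u _" "u _"]
    by (simp add: nn_integral_multc)
  also have "\<dots> = (\<integral>\<^sup>+x. \<integral>\<^sup>+t. \<integral>\<^sup>+y. ?D t x y * frac_kernel s (x - y) \<partial>lborel \<partial>lborel \<partial>lborel)"
    by (intro nn_integral_cong lborel_pair.Fubini') measurable
  also have "\<dots> = (\<integral>\<^sup>+t. \<integral>\<^sup>+x. \<integral>\<^sup>+y. ?D t x y * frac_kernel s (x - y) \<partial>lborel \<partial>lborel \<partial>lborel)"
    by (intro lborel_pair.Fubini') measurable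
  also have "\<dots> = (\<integral>\<^sup>+t. gagliardo s UNIV (indicator {x. t < u x}) \<partial>lborel)"
    unfolding gagliardo_UNIV by (simp add: indicator_def of_bool_def)
  finally show ?thesis .
qed

lemma layer_cake_weighted:
  fixes u g :: "'a::euclidean_space \<Rightarrow> real"
  assumes [measurable]: "u \<in> borel_measurable borel" "g \<in> borel_measurable borel"
    and "\<And>x. 0 \<le> u x" "\<And>x. 0 \<le> g x"
  shows "(\<integral>\<^sup>+x. ennreal (g x * u x) \<partial>lborel) =
    (\<integral>\<^sup>+t. (\<integral>\<^sup>+x. ennreal (g x) * indicator {x. t < u x} x \<partial>lborel) * indicator {0..} t \<partial>lborel)"
proof -
  have "ennreal (g x * u x) =
      (\<integral>\<^sup>+t. ennreal (g x) * of_bool (t < u x) * indicator {0..} t \<partial>lborel)" for x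
  proof -
    have "(\<integral>\<^sup>+t. ennreal (g x) * of_bool (t < u x) * indicator {0..} t \<partial>lborel)
       = (\<integral>\<^sup>+t. ennreal (g x) * indicator {0..<u x} t \<partial>lborel)"
      by (intro nn_integral_cong) (auto simp: indicator_def)
    also have "\<dots> = ennreal (g x) * ennreal (u x)"
      using assms(3)[of x] by (simp add: nn_integral_cmult_indicator)
    finally show ?thesis by (simp add: ennreal_mult' assms)
  qed
  then have "(\<integral>\<^sup>+x. ennreal (g x * u x) \<partial>lborel) =
      (\<integral>\<^sup>+x. \<integral>\<^sup>+t. ennreal (g x) * of_bool (t < u x) * indicator {0..} t \<partial>lborel \<partial>lborel)"
    by simp
  also have "\<dots> = (\<integral>\<^sup>+t. \<integral>\<^sup>+x. ennreal (g x) * of_bool (t < u x) * indicator {0..} t \<partial>lborel \<partial>lborel)"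
    by (intro lborel_pair.Fubini') measurable
  also have "\<dots> = (\<integral>\<^sup>+t. (\<integral>\<^sup>+x. ennreal (g x) * of_bool (t < u x) \<partial>lborel) * indicator {0..} t \<partial>lborel)"
    by (intro nn_integral_cong nn_integral_multc) measurable
  finally show ?thesis by (simp add: indicator_def of_bool_def)
qed

lemma weighted_volume_nn_integral:
  fixes g :: "'a::euclidean_space \<Rightarrow> real"
  assumes "integrable lborel g" "\<And>x. 0 \<le> g x" "A \<in> sets lborel"
  shows "ennreal (weighted_volume g A) = (\<integral>\<^sup>+x. ennreal (g x) * indicator A x \<partial>lborel)"
proof -
  have [measurable]: "g \<in> borel_measurable borel" "A \<in> sets borel" using assms by auto
  have "weighted_volume g A = (\<integral>x. indicator A x * g x \<partial>lborel)"
    unfolding weighted_volume_def set_lebesgue_integral_def by (simp add: integral_completion)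
  moreover have "integrable lborel (\<lambda>x. indicator A x * g x)"
    using integrable_mult_indicator[OF _ assms(1), of A] by simp
  ultimately have "ennreal (weighted_volume g A) = (\<integral>\<^sup>+x. ennreal (indicator A x * g x) \<partial>lborel)"
    using assms(2) by (simp add: nn_integral_eq_integral)
  also have "\<dots> = (\<integral>\<^sup>+x. ennreal (g x) * indicator A x \<partial>lborel)"
    by (intro nn_integral_cong) (auto simp: indicator_def)
  finally show ?thesis .
qed

text \<open>The product form of the Cheeger quotient also covers the sets of weighted volume zero, which the
  infimum leaves out; superlevel sets may well be of that kind.\<close>
lemma isoperimetric_inequality_cheeger:
  fixes g :: "'a::euclidean_space \<Rightarrow> real"
  assumes "A \<subseteq> \<Omega>" "A \<in> sets lebesgue"
  shows "cheeger s g \<Omega> * ennreal (weighted_volume g A) \<le> Per s A"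
proof (cases "0 < weighted_volume g A")
  case True
  then have "cheeger s g \<Omega> \<le> Per s A / ennreal (weighted_volume g A)"
    unfolding cheeger_def using assms by (intro INF_lower) auto
  then have "cheeger s g \<Omega> * ennreal (weighted_volume g A)
      \<le> Per s A / ennreal (weighted_volume g A) * ennreal (weighted_volume g A)"
    by (rule mult_right_mono) simp
  also have "\<dots> = Per s A"
    using True by (metis ennreal_eq_0_iff ennreal_mult_divide_eq ennreal_neq_top ennreal_times_divide
        linorder_not_le mult.commute)
  finally show ?thesis .
qed (simp add: ennreal_neg not_less)

text \<open>Apply the inequality for sets to each superlevel set of \<open>\<bar>u\<bar>\<close> and integrate over the levels. The
  set \<open>{x. t < \<bar>u x\<bar>}\<close> lies inside \<open>\<Omega>\<close> for \<open>t \<ge> 0\<close>; for \<open>t < 0\<close> it is the whole space, and such levels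
  do not occur in the layer-cake formula on the left.\<close>
lemma functional_cheeger_inequality:
  fixes u g :: "'a::euclidean_space \<Rightarrow> real"
  assumes u [measurable]: "u \<in> borel_measurable borel" and u0: "\<And>x. x \<notin> \<Omega> \<Longrightarrow> u x = 0"
    and g: "integrable lborel g" "\<And>x. 0 \<le> g x"
  shows "cheeger s g \<Omega> * (\<integral>\<^sup>+x. ennreal (g x * \<bar>u x\<bar>) \<partial>lborel) \<le> 1/2 * gagliardo s UNIV u"
proof -
  have [measurable]: "g \<in> borel_measurable borel" using g(1) by auto
  let ?A = "\<lambda>t. {x. t < \<bar>u x\<bar>}"
  have A: "?A t \<in> sets borel" for t by measurable
  have "(\<integral>\<^sup>+x. ennreal (g x * \<bar>u x\<bar>) \<partial>lborel)
      = (\<integral>\<^sup>+t. (\<integral>\<^sup>+x. ennreal (g x) * indicator (?A t) x \<partial>lborel) * indicator {0..} t \<partial>lborel)"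
    using g by (intro layer_cake_weighted) auto
  moreover have "(\<lambda>t. (\<integral>\<^sup>+x. ennreal (g x) * indicator (?A t) x \<partial>lborel) * indicator {0..} t)
      \<in> borel_measurable lborel"
    unfolding indicator_def by measurable
  ultimately have "cheeger s g \<Omega> * (\<integral>\<^sup>+x. ennreal (g x * \<bar>u x\<bar>) \<partial>lborel)
     = (\<integral>\<^sup>+t. cheeger s g \<Omega> * ((\<integral>\<^sup>+x. ennreal (g x) * indicator (?A t) x \<partial>lborel)
                 * indicator {0..} t) \<partial>lborel)"
    by (simp add: nn_integral_cmult)
  also have "\<dots> \<le> (\<integral>\<^sup>+t. 1/2 * gagliardo s UNIV (indicator (?A t)) \<partial>lborel)"
  proof (intro nn_integral_mono)
    fix t :: real
    show "cheeger s g \<Omega> * ((\<integral>\<^sup>+x. ennreal (g x) * indicator (?A t) x \<partial>lborel) * indicator {0..} t)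
         \<le> 1/2 * gagliardo s UNIV (indicator (?A t))"
    proof (cases "0 \<le> t")
      case True
      have "?A t \<subseteq> \<Omega>" using u0 True by force
      moreover have "?A t \<in> sets lebesgue" using A[of t] by (simp add: sets_completionI_sets)
      ultimately have "cheeger s g \<Omega> * ennreal (weighted_volume g (?A t)) \<le> Per s (?A t)"
        by (rule isoperimetric_inequality_cheeger)
      then show ?thesis
        using True A[of t] g by (simp add: weighted_volume_nn_integral Per_def)
    qed simp
  qed
  also have "\<dots> = 1/2 * (\<integral>\<^sup>+t. gagliardo s UNIV (indicator (?A t)) \<partial>lborel)"
  proof (rule nn_integral_cmult)
    show "(\<lambda>t. gagliardo s UNIV (indicator (?A t))) \<in> borel_measurable lborel"
      unfolding gagliardo_UNIV indicator_def by measurable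
  qed
  also have "(\<integral>\<^sup>+t. gagliardo s UNIV (indicator (?A t)) \<partial>lborel) = gagliardo s UNIV (\<lambda>x. \<bar>u x\<bar>)"
    by (rule coarea_formula[symmetric]) measurable
  also have "1/2 * gagliardo s UNIV (\<lambda>x. \<bar>u x\<bar>) \<le> 1/2 * gagliardo s UNIV u"
    by (intro mult_left_mono gagliardo_mono) auto
  finally show ?thesis .
qed

text \<open>A function of zero seminorm is almost everywhere constant, since the kernel is positive off the
  diagonal; the constant is read off at a point outside the bounded set \<open>\<Omega>\<close>.\<close>
lemma gagliardo_zero_imp_AE_zero:
  fixes u :: "'a::euclidean_space \<Rightarrow> real"
  assumes [measurable]: "u \<in> borel_measurable borel"
    and "bounded \<Omega>" and u0: "\<And>x. x \<notin> \<Omega> \<Longrightarrow> u x = 0"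
    and "gagliardo s UNIV u = 0"
  shows "AE x in lborel. u x = 0"
proof -
  have "AE x in lborel. (\<integral>\<^sup>+y. ennreal \<bar>u x - u y\<bar> * frac_kernel s (x - y) \<partial>lborel) = 0"
    using assms(4) unfolding gagliardo_UNIV by (subst (asm) nn_integral_0_iff_AE) auto
  then have ae: "AE x in lborel. AE y in lborel. u x = u y"
  proof eventually_elim
    case (elim x)
    then have "AE y in lborel. ennreal \<bar>u x - u y\<bar> * frac_kernel s (x - y) = 0"
      by (subst (asm) nn_integral_0_iff_AE) auto
    with AE_lborel_singleton[of x] show ?case
    proof eventually_elim
      case (elim y)
      then show ?case using frac_kernel_pos[of "x - y" s] by auto
    qed
  qed
  \<comment> \<open>The complement of \<open>\<Omega>\<close> is not a null set, since \<open>\<Omega>\<close> has finite measure and the space has not.\<close>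
  have "\<exists>x. x \<notin> \<Omega> \<and> (AE y in lborel. u x = u y)"
  proof (rule ccontr)
    assume "\<nexists>x. x \<notin> \<Omega> \<and> (AE y in lborel. u x = u y)"
    with ae have ae2: "AE x in lborel. x \<in> \<Omega>" by (auto elim!: eventually_mono)
    obtain r where "\<forall>x\<in>\<Omega>. norm x \<le> r" using \<open>bounded \<Omega>\<close> bounded_iff by blast
    then have r: "\<Omega> \<subseteq> cball 0 r" by auto
    have "emeasure lborel (UNIV :: 'a set) = emeasure lborel (cball (0::'a) r)"
      using ae2 r by (intro emeasure_eq_AE) (auto elim!: eventually_mono)
    then show False using emeasure_lborel_cball_finite[of "0::'a" r] by simp
  qed
  then show ?thesis using u0 by (auto elim!: eventually_mono)
qed

section \<open>Smooth bump functions\<close>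

text \<open>For \<open>m = 0\<close> this is the classical smooth function that is flat at \<open>0\<close>. The negative powers are
  included because differentiating produces them: the derivative of a member of the family is a
  combination of two others.\<close>
definition flat :: "nat \<Rightarrow> real \<Rightarrow> real" where
  "flat m t = (if 0 < t then exp (- (1 / t)) / t ^ m else 0)"

text \<open>Substituting \<open>x = 1 / t\<close> turns this into the fact that the exponential dominates powers. Since
  \<open>flat m h / h = flat (m + 1) h\<close>, the limit for \<open>m + 1\<close> is the derivative of \<open>flat m\<close> at \<open>0\<close>.\<close>
lemma flat_tendsto_0: "(flat m \<longlongrightarrow> 0) (at 0)"
proof -
  have "((\<lambda>x::real. x ^ m / exp x) \<longlongrightarrow> 0) at_top"
    by (rule tendsto_power_div_exp_0)
  then have "((\<lambda>t::real. (inverse t) ^ m / exp (inverse t)) \<longlongrightarrow> 0) (at_right 0)"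
    using filterlim_inverse_at_top_right by (rule filterlim_compose)
  moreover have "\<forall>\<^sub>F t in at_right 0. (inverse t) ^ m / exp (inverse t) = flat m t"
    unfolding eventually_at_right_field
    by (intro exI[of _ 1]) (auto simp: flat_def exp_minus field_simps)
  ultimately have "(flat m \<longlongrightarrow> 0) (at_right 0)"
    by (rule Lim_transform_eventually)
  moreover have "(flat m \<longlongrightarrow> 0) (at_left 0)"
  proof (rule Lim_transform_eventually[OF tendsto_const])
    show "\<forall>\<^sub>F t in at_left 0. 0 = flat m t"
      unfolding eventually_at_left_field by (intro exI[of _ "-1"]) (auto simp: flat_def)
  qed
  ultimately show ?thesis by (simp add: filterlim_split_at)
qed

lemma flat_has_derivative:
  "(flat m has_real_derivative (flat (m + 2) t - real m * flat (m + 1) t)) (at t)"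
proof -
  consider "t < 0" | "t = 0" | "0 < t" by linarith
  then show ?thesis
  proof cases
    case 1
    have "((\<lambda>_. 0) has_real_derivative (flat (m + 2) t - real m * flat (m + 1) t)) (at t)"
      using 1 by (simp add: flat_def)
    then show ?thesis
      by (rule has_field_derivative_transform_within_open[of _ _ _ "{..<0}"])
        (use 1 in \<open>auto simp: flat_def\<close>)
  next
    case 2
    have "((\<lambda>h. (flat m (0 + h) - flat m 0) / h) \<longlongrightarrow> 0) (at 0)"
    proof (rule Lim_transform_eventually[OF flat_tendsto_0[of "m + 1"]])
      show "\<forall>\<^sub>F h in at 0. flat (m + 1) h = (flat m (0 + h) - flat m 0) / h"
        unfolding eventually_at_filter
        by (rule always_eventually) (auto simp: flat_def)
    qed
    then show ?thesis using 2 by (simp add: DERIV_def flat_def)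
  next
    case 3
    have "((\<lambda>t. exp (- (1 / t)) / t ^ m) has_real_derivative
        (flat (m + 2) t - real m * flat (m + 1) t)) (at t)"
    proof -
      have "((\<lambda>t. exp (- (1 / t)) / t ^ m) has_real_derivative
        (exp (- (1/t)) * (1 / t^2) * t^m - exp (- (1/t)) * (real m * t ^ (m - 1))) / (t^m * t^m)) (at t)"
        using 3 by (auto intro!: derivative_eq_intros simp: power2_eq_square)
      moreover have "(exp (- (1/t)) * (1 / t^2) * t^m - exp (- (1/t)) * (real m * t ^ (m - 1))) / (t^m * t^m)
         = flat (m + 2) t - real m * flat (m + 1) t"
        using 3 by (cases m) (auto simp: flat_def divide_simps power2_eq_square algebra_simps)
      ultimately show ?thesis by simp
    qed
    then show ?thesis
      by (rule has_field_derivative_transform_within_open[of _ _ _ "{0<..}"])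
        (use 3 in \<open>auto simp: flat_def\<close>)
  qed
qed

text \<open>Smoothness is proved without computing any higher derivative, by exhibiting a set of differentiable
  functions that contains the partial derivatives of its members. This algebra is such a set; its
  generator for \<open>m = 0\<close> and \<open>c = 1 / \<epsilon>\<^sup>2\<close> is the standard bump on the ball of radius \<open>\<epsilon>\<close>.\<close>
inductive_set bump_algebra :: "real \<Rightarrow> ('a::euclidean_space \<Rightarrow> real) set" for c where
  const: "(\<lambda>x. a) \<in> bump_algebra c"
| coord: "(\<lambda>x. x \<bullet> i) \<in> bump_algebra c"
| flat: "(\<lambda>x. flat m (1 - c * (x \<bullet> x))) \<in> bump_algebra c"
| add: "\<phi> \<in> bump_algebra c \<Longrightarrow> \<psi> \<in> bump_algebra c \<Longrightarrow> (\<lambda>x. \<phi> x + \<psi> x) \<in> bump_algebra c"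
| mult: "\<phi> \<in> bump_algebra c \<Longrightarrow> \<psi> \<in> bump_algebra c \<Longrightarrow> (\<lambda>x. \<phi> x * \<psi> x) \<in> bump_algebra c"

lemma bump_algebra_derivative:
  fixes \<phi> :: "'a::euclidean_space \<Rightarrow> real"
  assumes "\<phi> \<in> bump_algebra c"
  shows "\<exists>D. (\<forall>x. (\<phi> has_derivative D x) (at x)) \<and> (\<forall>i. (\<lambda>x. D x i) \<in> bump_algebra c)"
  using assms
proof induction
  case (const a)
  show ?case
    by (rule exI[of _ "\<lambda>x h. 0"]) (auto intro: bump_algebra.const)
next
  case (coord i)
  show ?case
    by (rule exI[of _ "\<lambda>x h. h \<bullet> i"]) (auto intro: bump_algebra.const intro!: derivative_eq_intros)
next
  case (flat m)
  let ?q = "\<lambda>x::'a. 1 - c * (x \<bullet> x)"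
  let ?d = "\<lambda>x. flat (m + 2) (?q x) + (- real m) * flat (m + 1) (?q x)"
  let ?D = "\<lambda>x h. ?d x * ((- 2 * c) * (x \<bullet> h))"
  have "((\<lambda>x. flat m (?q x)) has_derivative ?D x) (at x)" for x
  proof -
    have "(?q has_derivative (\<lambda>h. (- 2 * c) * (x \<bullet> h))) (at x)"
      by (auto intro!: derivative_eq_intros simp: inner_commute algebra_simps)
    moreover have "(flat m has_derivative (*) (?d x)) (at (?q x))"
      using flat_has_derivative[of m "?q x"] unfolding has_field_derivative_def by simp
    ultimately show ?thesis by (rule has_derivative_compose)
  qed
  moreover have "(\<lambda>x. ?D x i) \<in> bump_algebra c" for i
    by (intro bump_algebra.intros)
  ultimately show ?case by (intro exI[of _ ?D] conjI allI)
next
  case (add \<phi> \<psi>)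
  then obtain D E where "\<forall>x. (\<phi> has_derivative D x) (at x)" "\<forall>i. (\<lambda>x. D x i) \<in> bump_algebra c"
    "\<forall>x. (\<psi> has_derivative E x) (at x)" "\<forall>i. (\<lambda>x. E x i) \<in> bump_algebra c" by blast
  then show ?case
    by (intro exI[of _ "\<lambda>x h. D x h + E x h"])
       (auto intro: bump_algebra.intros intro!: derivative_eq_intros)
next
  case (mult \<phi> \<psi>)
  then obtain D E where "\<forall>x. (\<phi> has_derivative D x) (at x)" "\<forall>i. (\<lambda>x. D x i) \<in> bump_algebra c"
    "\<forall>x. (\<psi> has_derivative E x) (at x)" "\<forall>i. (\<lambda>x. E x i) \<in> bump_algebra c" by blast
  with mult.hyps show ?case
    by (intro exI[of _ "\<lambda>x h. \<phi> x * E x h + D x h * \<psi> x"] conjI allI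
        bump_algebra.add bump_algebra.mult has_derivative_mult) auto
qed

lemma bump_algebra_continuous:
  "\<phi> \<in> bump_algebra c \<Longrightarrow> continuous_on UNIV \<phi>"
  using bump_algebra_derivative[of \<phi> c]
  by (auto simp: continuous_on_eq_continuous_at intro: has_derivative_continuous)

text \<open>The hypothesis passes to the partial derivatives, so the recursion defining \<^const>\<open>C_k\<close> never leaves
  the set \<open>S\<close>.\<close>
lemma C_k_if_closed_under_partial_derivatives:
  fixes S :: "('a::euclidean_space \<Rightarrow> real) set"
  assumes closed: "\<And>\<phi>. \<phi> \<in> S \<Longrightarrow>
      \<exists>D. (\<forall>x. (\<phi> has_derivative D x) (at x)) \<and> (\<forall>i\<in>Basis. (\<lambda>x. D x i) \<in> S)"
    and "\<phi> \<in> S"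
  shows "C_k k \<phi>"
  using \<open>\<phi> \<in> S\<close>
proof (induction k arbitrary: \<phi>)
  case 0
  then show ?case using closed[OF 0]
    by (auto simp: continuous_on_eq_continuous_at intro: has_derivative_continuous)
next
  case (Suc k)
  obtain D where D: "\<And>x. (\<phi> has_derivative D x) (at x)" "\<And>i. i \<in> Basis \<Longrightarrow> (\<lambda>x. D x i) \<in> S"
    using closed[OF Suc.prems] by blast
  have "frechet_derivative \<phi> (at x) = D x" for x
    using frechet_derivative_at[OF D(1)] by simp
  then show ?case using D Suc.IH by (auto simp: differentiable_def)
qed

section \<open>Mollification\<close>

text \<open>The mollification of \<open>u\<close> by the reflected kernel. The variable \<open>x\<close> occurs only in the smooth factor,
  so derivatives fall on \<open>\<rho>\<close>; and after a translation the integral is an average of the translates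
  \<open>u (x + z)\<close>, with no change of orientation.\<close>
definition correlate :: "('a::euclidean_space \<Rightarrow> real) \<Rightarrow> ('a \<Rightarrow> real) \<Rightarrow> 'a \<Rightarrow> real" where
  "correlate \<rho> u x = (\<integral>y. \<rho> (y - x) * u y \<partial>lborel)"

lemma uniform_bound_compact_support:
  fixes \<rho> :: "'a::euclidean_space \<Rightarrow> real"
  assumes "continuous_on UNIV \<rho>" "\<And>x. R < norm x \<Longrightarrow> \<rho> x = 0"
  shows "\<exists>B\<ge>0. \<forall>x. \<bar>\<rho> x\<bar> \<le> B"
proof -
  have "bounded (\<rho> ` cball 0 R)"
    by (intro compact_imp_bounded compact_continuous_image continuous_on_subset[OF assms(1)]) auto
  then obtain B where "\<forall>x\<in>cball 0 R. \<bar>\<rho> x\<bar> \<le> B" by (auto simp: bounded_iff)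
  then have B: "\<And>x. norm x \<le> R \<Longrightarrow> \<bar>\<rho> x\<bar> \<le> B" by auto
  have "\<bar>\<rho> x\<bar> \<le> max B 0" for x
    using B[of x] assms(2)[of x] by (cases "norm x \<le> R") auto
  then show ?thesis by (intro exI[of _ "max B 0"]) auto
qed

lemma uniformly_continuous_compact_support:
  fixes \<rho> :: "'a::euclidean_space \<Rightarrow> real"
  assumes "continuous_on UNIV \<rho>" and supp: "\<And>x. R < norm x \<Longrightarrow> \<rho> x = 0"
  shows "uniformly_continuous_on UNIV \<rho>"
proof -
  have uc: "uniformly_continuous_on (cball 0 (R + 1)) \<rho>"
    by (intro compact_uniformly_continuous continuous_on_subset[OF assms(1)]) auto
  show ?thesis
    unfolding uniformly_continuous_on_def
  proof (intro allI impI)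
    fix e :: real assume "0 < e"
    then obtain d where d: "0 < d" "\<And>x x'. \<lbrakk>norm x \<le> R + 1; norm x' \<le> R + 1; dist x' x < d\<rbrakk>
        \<Longrightarrow> dist (\<rho> x') (\<rho> x) < e"
      using uc unfolding uniformly_continuous_on_def by (auto simp: dist_norm)
    have "dist (\<rho> x') (\<rho> x) < e" if "dist x' x < min d 1" for x x'
    proof (cases "norm x \<le> R + 1 \<and> norm x' \<le> R + 1")
      case True then show ?thesis using d(2) that by auto
    next
      case False
      have "\<bar>norm x' - norm x\<bar> < 1"
        using norm_triangle_ineq3[of x' x] that by (simp add: dist_norm)
      with False have "R < norm x" "R < norm x'" by auto
      then show ?thesis using supp \<open>0 < e\<close> by simp
    qed
    then show "\<exists>d>0. \<forall>x\<in>UNIV. \<forall>x'\<in>UNIV. dist x' x < d \<longrightarrow> dist (\<rho> x') (\<rho> x) < e"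
      using d(1) by (intro exI[of _ "min d 1"]) auto
  qed
qed

lemma integrable_correlate:
  fixes \<rho> u :: "'a::euclidean_space \<Rightarrow> real"
  assumes \<rho>: "continuous_on UNIV \<rho>" "\<And>x. R < norm x \<Longrightarrow> \<rho> x = 0"
    and u: "integrable lborel u"
  shows "integrable lborel (\<lambda>y. \<rho> (y - x) * u y)"
proof -
  obtain B where B: "\<And>x. \<bar>\<rho> x\<bar> \<le> B" using uniform_bound_compact_support[OF \<rho>] by auto
  have [measurable]: "\<rho> \<in> borel_measurable borel" "u \<in> borel_measurable borel"
    using \<rho>(1) u by (auto intro: borel_measurable_continuous_onI)
  show ?thesis
  proof (rule Bochner_Integration.integrable_bound)
    show "integrable lborel (\<lambda>y. B * u y)" using u by simp
    show "AE y in lborel. norm (\<rho> (y - x) * u y) \<le> norm (B * u y)"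
      using B by (auto simp: abs_mult intro!: mult_right_mono order_trans[OF B])
  qed measurable
qed

text \<open>Differentiation under the integral sign for a factor \<open>u\<close> that is merely integrable. The partial
  derivatives of \<open>\<rho>\<close> are uniformly continuous by compactness of the support, so the first-order Taylor
  remainder of \<open>\<rho>\<close> is \<open>o(norm h)\<close> uniformly in the base point, and it survives integration against \<open>u\<close>.\<close>
lemma has_derivative_correlate:
  fixes \<rho> u :: "'a::euclidean_space \<Rightarrow> real"
  assumes D: "\<And>x. (\<rho> has_derivative D x) (at x)"
    and cont: "\<And>i. i \<in> Basis \<Longrightarrow> continuous_on UNIV (\<lambda>x. D x i)"
    and supp: "\<And>x. R < norm x \<Longrightarrow> \<rho> x = 0" "\<And>x i. R < norm x \<Longrightarrow> D x i = 0"
    and u: "integrable lborel u"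
  shows "(correlate \<rho> u has_derivative
           (\<lambda>h. \<Sum>i\<in>Basis. (h \<bullet> i) * (- correlate (\<lambda>z. D z i) u x))) (at x)"
  unfolding has_derivative_at_alt
proof (intro conjI allI impI)
  let ?f' = "\<lambda>h. \<Sum>i\<in>Basis. (h \<bullet> i) * (- correlate (\<lambda>z. D z i) u x)"
  show "bounded_linear ?f'"
    by (intro bounded_linear_sum bounded_linear_mult_const bounded_linear_inner_left)
  have \<rho>c: "continuous_on UNIV \<rho>"
    using D by (auto simp: continuous_on_eq_continuous_at intro: has_derivative_continuous)
  have lin: "D z h = (\<Sum>i\<in>Basis. (h \<bullet> i) * D z i)" for z h
  proof -
    have "linear (D z)" using D by (rule has_derivative_linear)
    then have "D z (\<Sum>i\<in>Basis. (h \<bullet> i) *\<^sub>R i) = (\<Sum>i\<in>Basis. (h \<bullet> i) *\<^sub>R D z i)"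
      by (simp add: linear_sum linear_scale)
    then show ?thesis by (simp add: euclidean_representation)
  qed
  fix e :: real assume "0 < e"
  define U where "U = (\<integral>y. \<bar>u y\<bar> \<partial>lborel)"
  have "0 \<le> U" unfolding U_def by simp
  \<comment> \<open>The dimension enters because the derivative is estimated one coordinate at a time; adding \<open>1\<close> avoids
    a division by zero for \<open>u = 0\<close>.\<close>
  define \<epsilon> where "\<epsilon> = e / (DIM('a) * (U + 1))"
  have "0 < \<epsilon>" unfolding \<epsilon>_def using \<open>0 < e\<close> \<open>0 \<le> U\<close> by (auto intro!: divide_pos_pos mult_pos_pos)
  have "\<forall>i\<in>Basis. \<exists>d>0. \<forall>z z'. dist z' z < d \<longrightarrow> dist (D z' i) (D z i) < \<epsilon>"
    using uniformly_continuous_compact_support[OF cont supp(2)] \<open>0 < \<epsilon>\<close>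
    by (auto simp: uniformly_continuous_on_def)
  then obtain d where d: "\<And>i. i \<in> Basis \<Longrightarrow> 0 < d i"
     "\<And>i z z'. i \<in> Basis \<Longrightarrow> dist z' z < d i \<Longrightarrow> dist (D z' i) (D z i) < \<epsilon>" by metis
  define d0 where "d0 = Min (d ` Basis)"
  have "0 < d0" unfolding d0_def using d(1) by (subst Min_gr_iff) auto
  have d0: "\<bar>D z' i - D z i\<bar> < \<epsilon>" if "i \<in> Basis" "norm (z' - z) < d0" for i z z'
  proof -
    have "d0 \<le> d i" unfolding d0_def using that by auto
    then show ?thesis using d(2)[OF that(1), of z' z] that by (simp add: dist_norm)
  qed
  have taylor: "\<bar>\<rho> (z + h) - \<rho> z - D z h\<bar> \<le> norm h * (DIM('a) * \<epsilon>)" if "norm h < d0" for z h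
  proof -
    have "norm (\<rho> (z + h) - \<rho> z - D z (z + h - z)) \<le> norm (z + h - z) * (DIM('a) * \<epsilon>)"
    proof (rule differentiable_bound_linearization[where S = "ball z d0" and f' = D])
      show "z + t *\<^sub>R (z + h - z) \<in> ball z d0" if "t \<in> {0..1}" for t
      proof -
        have "t * norm h \<le> 1 * norm h" using that by (intro mult_right_mono) auto
        then show ?thesis using that \<open>norm h < d0\<close> by (simp add: dist_norm)
      qed
      show "(\<rho> has_derivative D y) (at y within ball z d0)" for y
        using D by (rule has_derivative_at_withinI)
      show "onorm (D y - D z) \<le> DIM('a) * \<epsilon>" if "y \<in> ball z d0" for y
      proof (rule onorm_le)
        fix v
        have "D y v - D z v = (\<Sum>i\<in>Basis. (v \<bullet> i) * (D y i - D z i))"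
          unfolding lin[of _ v] by (simp add: sum_subtractf right_diff_distrib)
        then have "norm (D y v - D z v) \<le> (\<Sum>i\<in>Basis. norm ((v \<bullet> i) * (D y i - D z i)))"
          by (simp add: norm_sum)
        also have "\<dots> \<le> (\<Sum>i\<in>(Basis :: 'a set). norm v * \<epsilon>)"
        proof (rule sum_mono)
          fix i :: 'a assume i: "i \<in> Basis"
          have "\<bar>D y i - D z i\<bar> \<le> \<epsilon>"
            using d0[OF i, of y z] that by (simp add: dist_norm norm_minus_commute)
          then show "norm ((v \<bullet> i) * (D y i - D z i)) \<le> norm v * \<epsilon>"
            using Basis_le_norm[OF i, of v] \<open>0 < \<epsilon>\<close> by (auto simp: abs_mult intro!: mult_mono)
        qed
        finally show "norm ((D y - D z) v) \<le> DIM('a) * \<epsilon> * norm v" by (simp add: algebra_simps)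
      qed
      show "z \<in> ball z d0" using \<open>0 < d0\<close> by simp
    qed
    then show ?thesis by simp
  qed
  show "\<exists>d>0. \<forall>y. norm (y - x) < d \<longrightarrow>
      norm (correlate \<rho> u y - correlate \<rho> u x - ?f' (y - x)) \<le> e * norm (y - x)"
  proof (intro exI[of _ d0] conjI allI impI)
    show "0 < d0" by fact
    fix x' assume x': "norm (x' - x) < d0"
    let ?h = "x' - x"
    have int: "integrable lborel (\<lambda>y. \<rho> (y - a) * u y)" for a
      using \<rho>c supp(1) u by (rule integrable_correlate)
    have int': "integrable lborel (\<lambda>y. D (y - x) i * u y)" if "i \<in> Basis" for i
      using cont[OF that] supp(2) u by (rule integrable_correlate)
    have "?f' ?h = (\<integral>y. - (\<Sum>i\<in>Basis. (?h \<bullet> i) * (D (y - x) i * u y)) \<partial>lborel)"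
      unfolding correlate_def using int' by (simp add: sum_negf)
    also have "\<dots> = (\<integral>y. - D (y - x) ?h * u y \<partial>lborel)"
      by (intro Bochner_Integration.integral_cong) (auto simp: lin[of _ ?h] sum_distrib_left sum_distrib_right mult_ac)
    finally have f': "?f' ?h = (\<integral>y. - D (y - x) ?h * u y \<partial>lborel)" .
    have intf': "integrable lborel (\<lambda>y. - D (y - x) ?h * u y)"
    proof -
      have "integrable lborel (\<lambda>y. - (\<Sum>i\<in>Basis. (?h \<bullet> i) * (D (y - x) i * u y)))"
        using int' by (intro integrable_minus Bochner_Integration.integrable_sum integrable_mult_right) auto
      also have "(\<lambda>y. - (\<Sum>i\<in>Basis. (?h \<bullet> i) * (D (y - x) i * u y))) = (\<lambda>y. - D (y - x) ?h * u y)"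
        by (auto simp: lin[of _ ?h] sum_distrib_left sum_distrib_right mult_ac)
      finally show ?thesis .
    qed
    have "correlate \<rho> u x' - correlate \<rho> u x - ?f' ?h
       = (\<integral>y. \<rho> (y - x') * u y - \<rho> (y - x) * u y - (- D (y - x) ?h * u y) \<partial>lborel)"
      unfolding f' unfolding correlate_def using int intf' by simp
    also have "norm \<dots> \<le> (\<integral>y. norm ?h * (DIM('a) * \<epsilon>) * \<bar>u y\<bar> \<partial>lborel)"
    proof (rule order_trans[OF integral_norm_bound])
      show "(\<integral>y. norm (\<rho> (y - x') * u y - \<rho> (y - x) * u y - (- D (y - x) ?h * u y)) \<partial>lborel)
         \<le> (\<integral>y. norm ?h * (DIM('a) * \<epsilon>) * \<bar>u y\<bar> \<partial>lborel)"
      proof (rule integral_mono)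
        show "integrable lborel (\<lambda>y. norm (\<rho> (y - x') * u y - \<rho> (y - x) * u y - (- D (y - x) ?h * u y)))"
          using int intf' by (intro integrable_norm Bochner_Integration.integrable_diff) auto
        show "integrable lborel (\<lambda>y. norm ?h * (DIM('a) * \<epsilon>) * \<bar>u y\<bar>)" using u by auto
        fix y
        have "\<bar>\<rho> ((y - x) + - ?h) - \<rho> (y - x) - D (y - x) (- ?h)\<bar> \<le> norm (- ?h) * (DIM('a) * \<epsilon>)"
          using x' by (intro taylor) (simp add: norm_minus_commute)
        moreover have "D (y - x) (- ?h) = - D (y - x) ?h"
          using has_derivative_linear[OF D, of "y - x"] by (rule linear_neg)
        ultimately have "\<bar>\<rho> (y - x') - \<rho> (y - x) - (- D (y - x) ?h)\<bar> \<le> norm ?h * (DIM('a) * \<epsilon>)"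
          by (simp add: norm_minus_commute)
        then have "\<bar>\<rho> (y - x') - \<rho> (y - x) - (- D (y - x) ?h)\<bar> * \<bar>u y\<bar>
            \<le> norm ?h * (DIM('a) * \<epsilon>) * \<bar>u y\<bar>" by (rule mult_right_mono) simp
        then show "norm (\<rho> (y - x') * u y - \<rho> (y - x) * u y - (- D (y - x) ?h * u y))
           \<le> norm ?h * (DIM('a) * \<epsilon>) * \<bar>u y\<bar>"
          by (simp add: abs_mult[symmetric] algebra_simps)
      qed
    qed
    also have "\<dots> = norm ?h * (DIM('a) * \<epsilon> * U)" unfolding U_def by simp
    also have "\<dots> \<le> norm ?h * e"
    proof (rule mult_left_mono)
      have "DIM('a) * \<epsilon> * U = e * (U / (U + 1))" unfolding \<epsilon>_def using \<open>0 \<le> U\<close> by simp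
      also have "\<dots> \<le> e * 1" using \<open>0 < e\<close> \<open>0 \<le> U\<close> by (intro mult_left_mono) auto
      finally show "DIM('a) * \<epsilon> * U \<le> e" by simp
    qed simp
    finally show "norm (correlate \<rho> u x' - correlate \<rho> u x - ?f' ?h) \<le> e * norm ?h"
      by (simp add: mult.commute)
  qed
qed

text \<open>The correlations of \<open>u\<close> with compactly supported elements of the bump algebra form a set closed under
  partial derivatives: the derivative of \<open>\<rho> (y - x)\<close> in \<open>x\<close> is \<open>- D \<rho> (y - x)\<close>, and \<open>D \<rho>\<close> vanishes wherever
  \<open>\<rho>\<close> vanishes locally.\<close>
lemma correlate_bump_C_k:
  fixes \<rho> u :: "'a::euclidean_space \<Rightarrow> real"
  assumes "\<rho> \<in> bump_algebra c" "\<And>x. R < norm x \<Longrightarrow> \<rho> x = 0" and u: "integrable lborel u"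
  shows "C_k k (correlate \<rho> u)"
proof (rule C_k_if_closed_under_partial_derivatives)
  let ?S = "{correlate \<rho> u | \<rho>. \<rho> \<in> bump_algebra c \<and> (\<forall>x. R < norm x \<longrightarrow> \<rho> x = 0)}"
  show "correlate \<rho> u \<in> ?S" using assms by blast
  fix \<phi> assume "\<phi> \<in> ?S"
  then obtain \<rho> where \<phi>: "\<phi> = correlate \<rho> u" and \<rho>: "\<rho> \<in> bump_algebra c"
    and supp: "\<And>x. R < norm x \<Longrightarrow> \<rho> x = 0" by blast
  obtain D where D: "\<And>x. (\<rho> has_derivative D x) (at x)" "\<And>i. (\<lambda>x. D x i) \<in> bump_algebra c"
    using bump_algebra_derivative[OF \<rho>] by blast
  have suppD: "D x i = 0" if "R < norm x" for x i
  proof -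
    have "((\<lambda>_. 0) has_derivative D x) (at x)"
    proof (rule has_derivative_transform_within_open[OF D(1)])
      show "open {x::'a. R < norm x}" by (intro open_Collect_less continuous_intros)
    qed (use that supp in auto)
    then have "D x = (\<lambda>_. 0)"
      by (rule has_derivative_unique) simp
    then show ?thesis by simp
  qed
  let ?F = "\<lambda>x h. \<Sum>i\<in>Basis. (h \<bullet> i) * (- correlate (\<lambda>z. D z i) u x)"
  have "(\<phi> has_derivative ?F x) (at x)" for x
    unfolding \<phi> using D(1) bump_algebra_continuous[OF D(2)] supp suppD u
    by (rule has_derivative_correlate)
  moreover have "(\<lambda>x. ?F x i) \<in> ?S" if i: "i \<in> Basis" for i
  proof -
    have "?F x i = correlate (\<lambda>z. (-1) * D z i) u x" for x
      using i by (simp add: inner_Basis correlate_def if_distrib if_distribR cong: if_cong)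
    moreover have "(\<lambda>z. (-1) * D z i) \<in> bump_algebra c"
      using D(2) by (intro bump_algebra.mult bump_algebra.const)
    ultimately show ?thesis using suppD by fastforce
  qed
  ultimately show "\<exists>D. (\<forall>x. (\<phi> has_derivative D x) (at x)) \<and> (\<forall>i\<in>Basis. (\<lambda>x. D x i) \<in> ?S)"
    by (intro exI[of _ ?F] conjI allI ballI)
qed

lemma nn_integral_lborel_translate:
  fixes F :: "'a::euclidean_space \<Rightarrow> ennreal"
  assumes [measurable]: "F \<in> borel_measurable borel"
  shows "(\<integral>\<^sup>+x. F (x + a) \<partial>lborel) = (\<integral>\<^sup>+x. F x \<partial>lborel)"
proof -
  have "(\<integral>\<^sup>+x. F x \<partial>lborel) = (\<integral>\<^sup>+x. F x \<partial>(distr lborel borel ((+) a)))"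
    by (simp add: lborel_distr_plus)
  also have "\<dots> = (\<integral>\<^sup>+x. F (a + x) \<partial>lborel)"
    by (rule nn_integral_distr) measurable
  finally show ?thesis by (simp add: add.commute)
qed

lemma integral_lborel_translate:
  fixes F :: "'a::euclidean_space \<Rightarrow> real"
  assumes [measurable]: "F \<in> borel_measurable borel"
  shows "(\<integral>x. F (x + a) \<partial>lborel) = (\<integral>x. F x \<partial>lborel)"
proof -
  have "(\<integral>x. F x \<partial>lborel) = (\<integral>x. F x \<partial>(distr lborel borel ((+) a)))"
    by (simp add: lborel_distr_plus)
  also have "\<dots> = (\<integral>x. F (a + x) \<partial>lborel)"
    by (rule integral_distr) measurable
  finally show ?thesis by (simp add: add.commute)
qed

lemma gagliardo_translate:
  fixes u :: "'a::euclidean_space \<Rightarrow> real"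
  assumes [measurable]: "u \<in> borel_measurable borel"
  shows "gagliardo s UNIV (\<lambda>x. u (x + a)) = gagliardo s UNIV u"
proof -
  let ?I = "\<lambda>x. \<integral>\<^sup>+y. ennreal \<bar>u x - u y\<bar> * frac_kernel s (x - y) \<partial>lborel"
  have "(\<integral>\<^sup>+y. ennreal \<bar>u (x + a) - u (y + a)\<bar> * frac_kernel s (x - y) \<partial>lborel) = ?I (x + a)" for x
    using nn_integral_lborel_translate[of "\<lambda>y. ennreal \<bar>u (x + a) - u y\<bar> * frac_kernel s (x + a - y)" a]
    by simp
  moreover have "(\<integral>\<^sup>+x. ?I (x + a) \<partial>lborel) = (\<integral>\<^sup>+x. ?I x \<partial>lborel)"
    by (rule nn_integral_lborel_translate) measurable
  ultimately show ?thesis unfolding gagliardo_UNIV by simp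
qed

lemma integrable_prob_density_mult:
  fixes \<rho> v :: "'a::euclidean_space \<Rightarrow> real"
  assumes [measurable]: "\<rho> \<in> borel_measurable borel" "v \<in> borel_measurable borel"
    and "\<And>z. 0 \<le> \<rho> z" "(\<integral>\<^sup>+z. ennreal (\<rho> z) \<partial>lborel) = 1" "\<And>x. \<bar>v x\<bar> \<le> B"
  shows "integrable lborel (\<lambda>z. \<rho> z * v z)"
proof -
  have \<rho>: "integrable lborel \<rho>" using assms by (intro integrableI_nonneg) auto
  show ?thesis
  proof (rule Bochner_Integration.integrable_bound)
    show "integrable lborel (\<lambda>z. B * \<rho> z)" using \<rho> by simp
    have "\<bar>\<rho> z * v z\<bar> \<le> \<bar>B * \<rho> z\<bar>" for z
    proof -
      have "\<bar>\<rho> z * v z\<bar> = \<rho> z * \<bar>v z\<bar>" using assms(3)[of z] by (simp add: abs_mult)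
      also have "\<dots> \<le> \<rho> z * B" using assms(3,5) by (intro mult_left_mono) auto
      finally show ?thesis by (simp add: mult.commute)
    qed
    then show "AE z in lborel. norm (\<rho> z * v z) \<le> norm (B * \<rho> z)" by simp
  qed measurable
qed

lemma correlate_eq_average:
  fixes \<rho> u :: "'a::euclidean_space \<Rightarrow> real"
  assumes [measurable]: "\<rho> \<in> borel_measurable borel" "u \<in> borel_measurable borel"
  shows "correlate \<rho> u x = (\<integral>z. \<rho> z * u (x + z) \<partial>lborel)"
  unfolding correlate_def
  using integral_lborel_translate[of "\<lambda>y. \<rho> (y - x) * u y" x] by (simp add: add.commute)

lemma correlate_measurable [measurable]:
  fixes \<rho> u :: "'a::euclidean_space \<Rightarrow> real"
  assumes [measurable]: "\<rho> \<in> borel_measurable borel" "u \<in> borel_measurable borel"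
  shows "correlate \<rho> u \<in> borel_measurable borel"
proof -
  have "(\<lambda>x. \<integral>y. \<rho> (y - x) * u y \<partial>lborel) \<in> borel_measurable lborel" by measurable
  then show ?thesis by (simp add: correlate_def[abs_def])
qed

text \<open>The seminorm is convex and translation invariant, and a mollification is an average of translates.\<close>
lemma gagliardo_correlate_le:
  fixes \<rho> u :: "'a::euclidean_space \<Rightarrow> real"
  assumes [measurable]: "\<rho> \<in> borel_measurable borel" "u \<in> borel_measurable borel"
    and \<rho>: "\<And>z. 0 \<le> \<rho> z" "(\<integral>\<^sup>+z. ennreal (\<rho> z) \<partial>lborel) = 1" and u: "\<And>x. \<bar>u x\<bar> \<le> B"
  shows "gagliardo s UNIV (correlate \<rho> u) \<le> gagliardo s UNIV u"
proof -
  have bd: "ennreal \<bar>correlate \<rho> u x - correlate \<rho> u y\<bar>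
      \<le> (\<integral>\<^sup>+z. ennreal (\<rho> z) * ennreal \<bar>u (x + z) - u (y + z)\<bar> \<partial>lborel)" for x y
  proof -
    have i: "integrable lborel (\<lambda>z. \<rho> z * u (x + z))" for x
      by (rule integrable_prob_density_mult[OF _ _ \<rho> u]) measurable
    have "correlate \<rho> u x - correlate \<rho> u y = (\<integral>z. \<rho> z * u (x + z) - \<rho> z * u (y + z) \<partial>lborel)"
      using i by (simp add: correlate_eq_average)
    also have "ennreal \<bar>\<dots>\<bar> \<le> (\<integral>\<^sup>+z. ennreal \<bar>\<rho> z * u (x + z) - \<rho> z * u (y + z)\<bar> \<partial>lborel)"
      using integral_norm_bound_ennreal[of lborel "\<lambda>z. \<rho> z * u (x + z) - \<rho> z * u (y + z)"] i
      by simp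
    also have "\<dots> = (\<integral>\<^sup>+z. ennreal (\<rho> z) * ennreal \<bar>u (x + z) - u (y + z)\<bar> \<partial>lborel)"
      using \<rho>(1) by (simp add: right_diff_distrib[symmetric] abs_mult ennreal_mult')
    finally show ?thesis .
  qed
  have "gagliardo s UNIV (correlate \<rho> u) \<le> (\<integral>\<^sup>+x. \<integral>\<^sup>+y.
      (\<integral>\<^sup>+z. ennreal (\<rho> z) * ennreal \<bar>u (x + z) - u (y + z)\<bar> \<partial>lborel) * frac_kernel s (x - y) \<partial>lborel \<partial>lborel)"
    unfolding gagliardo_UNIV by (intro nn_integral_mono mult_right_mono bd) auto
  also have "\<dots> = (\<integral>\<^sup>+x. \<integral>\<^sup>+y. \<integral>\<^sup>+z. ennreal (\<rho> z) *
      (ennreal \<bar>u (x + z) - u (y + z)\<bar> * frac_kernel s (x - y)) \<partial>lborel \<partial>lborel \<partial>lborel)"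
    by (simp add: nn_integral_multc[symmetric] mult.assoc)
  also have "\<dots> = (\<integral>\<^sup>+x. \<integral>\<^sup>+z. \<integral>\<^sup>+y. ennreal (\<rho> z) *
      (ennreal \<bar>u (x + z) - u (y + z)\<bar> * frac_kernel s (x - y)) \<partial>lborel \<partial>lborel \<partial>lborel)"
    by (intro nn_integral_cong lborel_pair.Fubini') measurable
  also have "\<dots> = (\<integral>\<^sup>+z. \<integral>\<^sup>+x. \<integral>\<^sup>+y. ennreal (\<rho> z) *
      (ennreal \<bar>u (x + z) - u (y + z)\<bar> * frac_kernel s (x - y)) \<partial>lborel \<partial>lborel \<partial>lborel)"
    by (intro lborel_pair.Fubini') measurable
  also have "\<dots> = (\<integral>\<^sup>+z. ennreal (\<rho> z) * gagliardo s UNIV (\<lambda>x. u (x + z)) \<partial>lborel)"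
    unfolding gagliardo_UNIV by (simp add: nn_integral_cmult)
  also have "\<dots> = gagliardo s UNIV u"
    by (simp add: gagliardo_translate nn_integral_multc \<rho>(2))
  finally show ?thesis .
qed

text \<open>Finiteness of the seminorm replaces the continuity of translations in \<open>L\<^sup>1\<close>: the average of
  \<open>\<bar>u (x + z) - u x\<bar>\<close> against \<open>\<rho>\<close> is compared with the average against the singular kernel.\<close>
lemma correlate_L1_le:
  fixes \<rho> u :: "'a::euclidean_space \<Rightarrow> real"
  assumes [measurable]: "\<rho> \<in> borel_measurable borel" "u \<in> borel_measurable borel"
    and \<rho>: "\<And>z. 0 \<le> \<rho> z" "(\<integral>\<^sup>+z. ennreal (\<rho> z) \<partial>lborel) = 1" and u: "\<And>x. \<bar>u x\<bar> \<le> B"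
    and dom: "\<And>z. z \<noteq> 0 \<Longrightarrow> ennreal (\<rho> z) \<le> M * frac_kernel s z"
  shows "(\<integral>\<^sup>+x. ennreal \<bar>correlate \<rho> u x - u x\<bar> \<partial>lborel) \<le> M * gagliardo s UNIV u"
proof -
  have "ennreal \<bar>correlate \<rho> u x - u x\<bar>
      \<le> M * (\<integral>\<^sup>+y. ennreal \<bar>u x - u y\<bar> * frac_kernel s (x - y) \<partial>lborel)" for x
  proof -
    have i: "integrable lborel (\<lambda>z. \<rho> z * u (x + z))" "integrable lborel (\<lambda>z. \<rho> z * u x)"
      by (rule integrable_prob_density_mult[OF _ _ \<rho> u]; measurable)+
    have i\<rho>: "integrable lborel \<rho>" using \<rho> by (intro integrableI_nonneg) auto
    then have "(\<integral>z. \<rho> z \<partial>lborel) = 1"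
      using \<rho> by (simp add: integral_eq_nn_integral)
    then have "correlate \<rho> u x - u x = (\<integral>z. \<rho> z * u (x + z) - \<rho> z * u x \<partial>lborel)"
      using i i\<rho> by (simp add: correlate_eq_average)
    also have "ennreal \<bar>\<dots>\<bar> \<le> (\<integral>\<^sup>+z. ennreal \<bar>\<rho> z * u (x + z) - \<rho> z * u x\<bar> \<partial>lborel)"
      using integral_norm_bound_ennreal[of lborel "\<lambda>z. \<rho> z * u (x + z) - \<rho> z * u x"] i
      by simp
    also have "\<dots> = (\<integral>\<^sup>+z. ennreal (\<rho> z) * ennreal \<bar>u (x + z) - u x\<bar> \<partial>lborel)"
      using \<rho>(1) by (simp add: right_diff_distrib[symmetric] abs_mult ennreal_mult')
    also have "\<dots> \<le> (\<integral>\<^sup>+z. M * frac_kernel s z * ennreal \<bar>u (x + z) - u x\<bar> \<partial>lborel)"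
    proof (intro nn_integral_mono)
      fix z
      show "ennreal (\<rho> z) * ennreal \<bar>u (x + z) - u x\<bar> \<le> M * frac_kernel s z * ennreal \<bar>u (x + z) - u x\<bar>"
        using dom[of z] by (cases "z = 0") (auto intro: mult_right_mono)
    qed
    also have "\<dots> = M * (\<integral>\<^sup>+z. frac_kernel s z * ennreal \<bar>u (x + z) - u x\<bar> \<partial>lborel)"
      by (simp add: mult.assoc nn_integral_cmult)
    also have "(\<integral>\<^sup>+z. frac_kernel s z * ennreal \<bar>u (x + z) - u x\<bar> \<partial>lborel)
        = (\<integral>\<^sup>+y. ennreal \<bar>u x - u y\<bar> * frac_kernel s (x - y) \<partial>lborel)"
      using nn_integral_lborel_translate[of "\<lambda>y. ennreal \<bar>u x - u y\<bar> * frac_kernel s (y - x)" x]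
      by (simp add: frac_kernel_minus[of s x] add.commute mult.commute abs_minus_commute)
    finally show ?thesis .
  qed
  then have "(\<integral>\<^sup>+x. ennreal \<bar>correlate \<rho> u x - u x\<bar> \<partial>lborel)
      \<le> (\<integral>\<^sup>+x. M * (\<integral>\<^sup>+y. ennreal \<bar>u x - u y\<bar> * frac_kernel s (x - y) \<partial>lborel) \<partial>lborel)"
    by (rule nn_integral_mono)
  then show ?thesis unfolding gagliardo_UNIV by (simp add: nn_integral_cmult)
qed

text \<open>A bump of mass one on the ball of radius \<open>\<epsilon>\<close> is at most a constant times \<open>\<epsilon> powr (- n)\<close>, where \<open>n\<close> is
  the dimension, while the singular kernel is at least \<open>\<epsilon> powr (- (n + s))\<close> on that ball. The ratio
  \<open>\<epsilon> powr s\<close> is the rate at which mollifications converge in \<open>L\<^sup>1\<close>.\<close>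
lemma mollifier_exists:
  fixes \<epsilon> s :: real
  assumes "0 < \<epsilon>" "0 < s"
  defines "C \<equiv> exp 2 * 2 ^ DIM('a) / unit_ball_vol (real DIM('a))"
  shows "\<exists>\<rho> :: 'a::euclidean_space \<Rightarrow> real. \<rho> \<in> bump_algebra (1 / \<epsilon>\<^sup>2) \<and> (\<forall>z. 0 \<le> \<rho> z) \<and>
    (\<forall>z. \<epsilon> \<le> norm z \<longrightarrow> \<rho> z = 0) \<and> (\<integral>\<^sup>+z. ennreal (\<rho> z) \<partial>lborel) = 1 \<and>
    (\<forall>z. z \<noteq> 0 \<longrightarrow> ennreal (\<rho> z) \<le> ennreal (C * \<epsilon> powr s) * frac_kernel s z)"
proof -
  define b :: "'a \<Rightarrow> real" where "b = (\<lambda>z. flat 0 (1 - (1 / \<epsilon>\<^sup>2) * (z \<bullet> z)))"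
  have b: "b \<in> bump_algebra (1 / \<epsilon>\<^sup>2)" unfolding b_def by (rule bump_algebra.flat)
  have [measurable]: "b \<in> borel_measurable borel"
    using bump_algebra_continuous[OF b] by (rule borel_measurable_continuous_onI)
  have b01: "0 \<le> b z" "b z \<le> 1" for z by (auto simp: b_def flat_def)
  have b_out: "b z = 0" if "\<epsilon> \<le> norm z" for z
  proof -
    have "\<epsilon>\<^sup>2 \<le> z \<bullet> z" using that \<open>0 < \<epsilon>\<close> unfolding power2_norm_eq_inner[symmetric] by (intro power_mono) auto
    then show ?thesis using \<open>0 < \<epsilon>\<close> by (simp add: b_def flat_def field_simps)
  qed
  \<comment> \<open>On the ball of half the radius the argument of \<^const>\<open>flat\<close> is at least \<open>1 / 2\<close>; this bounds the mass
    of the bump from below.\<close>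
  have b_in: "exp (- 2) \<le> b z" if "norm z < \<epsilon> / 2" for z
  proof -
    have "z \<bullet> z \<le> (\<epsilon> / 2)\<^sup>2" using that unfolding power2_norm_eq_inner[symmetric] by (intro power_mono) auto
    then have "(1 / \<epsilon>\<^sup>2) * (z \<bullet> z) \<le> (1 / \<epsilon>\<^sup>2) * (\<epsilon> / 2)\<^sup>2" by (intro mult_left_mono) auto
    also have "\<dots> = 1 / 4" using \<open>0 < \<epsilon>\<close> by (simp add: power2_eq_square)
    finally have "1 / 2 \<le> 1 - (1 / \<epsilon>\<^sup>2) * (z \<bullet> z)" by linarith
    then obtain t where t: "t = 1 - (1 / \<epsilon>\<^sup>2) * (z \<bullet> z)" "1 / 2 \<le> t" by blast
    have "1 / t \<le> 1 / (1 / 2)" using t(2) by (intro divide_left_mono) auto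
    then show ?thesis unfolding b_def flat_def t(1)[symmetric] using t(2) by auto
  qed
  define vol where "vol = unit_ball_vol (real DIM('a)) * (\<epsilon> / 2) ^ DIM('a)"
  have vol: "0 < vol" unfolding vol_def using \<open>0 < \<epsilon>\<close> by simp
  define I where "I = (\<integral>\<^sup>+z. ennreal (b z) \<partial>lborel)"
  have "I \<le> (\<integral>\<^sup>+z. indicator (ball (0::'a) \<epsilon>) z \<partial>lborel)"
    unfolding I_def
  proof (intro nn_integral_mono)
    fix z show "ennreal (b z) \<le> indicator (ball 0 \<epsilon>) z"
      using b01[of z] b_out[of z] by (auto simp: indicator_def)
  qed
  also have "\<dots> < \<infinity>" using emeasure_lborel_ball_finite[of "0::'a" \<epsilon>] by simp
  finally have "I < \<infinity>" .
  have "ennreal (exp (- 2) * vol) = ennreal (exp (- 2)) * emeasure lborel (ball (0::'a) (\<epsilon> / 2))"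
    using \<open>0 < \<epsilon>\<close> by (simp add: emeasure_ball vol_def ennreal_mult')
  also have "\<dots> = (\<integral>\<^sup>+z. ennreal (exp (- 2)) * indicator (ball (0::'a) (\<epsilon> / 2)) z \<partial>lborel)"
    by (simp add: nn_integral_cmult_indicator)
  also have "\<dots> \<le> I"
    unfolding I_def
  proof (intro nn_integral_mono)
    fix z :: 'a show "ennreal (exp (- 2)) * indicator (ball 0 (\<epsilon> / 2)) z \<le> ennreal (b z)"
      using b_in[of z] by (auto simp: indicator_def intro: ennreal_leI)
  qed
  finally have I_ge: "ennreal (exp (- 2) * vol) \<le> I" .
  obtain m where m: "I = ennreal m" "0 \<le> m" using \<open>I < \<infinity>\<close> by (cases I) auto
  have m_ge: "exp (- 2) * vol \<le> m" using I_ge m by (simp add: ennreal_le_iff)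
  have "0 < m" using m_ge vol by (smt (verit) exp_gt_zero mult_pos_pos)
  define \<rho> where "\<rho> = (\<lambda>z. (1 / m) * b z)"
  have "\<rho> \<in> bump_algebra (1 / \<epsilon>\<^sup>2)" unfolding \<rho>_def by (intro bump_algebra.mult bump_algebra.const b)
  moreover have "0 \<le> \<rho> z" for z using b01 \<open>0 < m\<close> by (simp add: \<rho>_def)
  moreover have "\<rho> z = 0" if "\<epsilon> \<le> norm z" for z using b_out that by (simp add: \<rho>_def)
  moreover have "(\<integral>\<^sup>+z. ennreal (\<rho> z) \<partial>lborel) = 1"
  proof -
    have "(\<integral>\<^sup>+z. ennreal (\<rho> z) \<partial>lborel) = ennreal (1 / m) * I"
      unfolding \<rho>_def I_def using b01 \<open>0 < m\<close> by (simp add: ennreal_mult nn_integral_cmult del: times_divide_eq_left)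
    then show ?thesis using \<open>0 < m\<close> m by (simp add: ennreal_mult'[symmetric])
  qed
  moreover have "ennreal (\<rho> z) \<le> ennreal (C * \<epsilon> powr s) * frac_kernel s z" if "z \<noteq> 0" for z
  proof (cases "norm z < \<epsilon>")
    case True
    have "\<rho> z \<le> 1 / m" using b01 \<open>0 < m\<close> by (simp add: \<rho>_def field_simps)
    also have "\<dots> \<le> 1 / (exp (- 2) * vol)" using m_ge vol \<open>0 < m\<close> by (intro divide_left_mono mult_pos_pos) auto
    also have "\<dots> = C * \<epsilon> powr s * (1 / \<epsilon> powr (DIM('a) + s))"
      using \<open>0 < \<epsilon>\<close> by (simp add: C_def vol_def exp_minus field_simps powr_add powr_realpow)
    also have "\<dots> \<le> C * \<epsilon> powr s * (1 / norm z powr (DIM('a) + s))"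
      using True that \<open>0 < s\<close> \<open>0 < \<epsilon>\<close>
      by (intro mult_left_mono divide_left_mono powr_mono2) (auto simp: C_def)
    finally show ?thesis
      unfolding frac_kernel_def using \<open>0 < \<epsilon>\<close>
      by (simp add: ennreal_mult'[symmetric] C_def ennreal_leI)
  next
    case False
    then show ?thesis using \<open>\<And>z. \<epsilon> \<le> norm z \<Longrightarrow> \<rho> z = 0\<close>[of z] by simp
  qed
  ultimately show ?thesis by (intro exI[of _ \<rho>] conjI allI impI)
qed

section \<open>Kernel integrals and the distance to the boundary\<close>

text \<open>Integration of radial functions by the layers \<open>norm z < t\<close>, which only needs the volume of balls.\<close>
lemma nn_integral_radial_layers:
  fixes w :: "real \<Rightarrow> ennreal"
  assumes [measurable]: "w \<in> borel_measurable borel"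
  shows "(\<integral>\<^sup>+z. (\<integral>\<^sup>+t. w t * indicator {t. norm z < t} t \<partial>lborel) \<partial>(lborel :: 'a::euclidean_space measure))
       = (\<integral>\<^sup>+t. w t * ennreal (unit_ball_vol (real DIM('a)) * t ^ DIM('a)) * indicator {0..} t \<partial>lborel)"
proof -
  have "(\<integral>\<^sup>+z. (\<integral>\<^sup>+t. w t * indicator {t. norm z < t} t \<partial>lborel) \<partial>(lborel :: 'a measure))
      = (\<integral>\<^sup>+t. \<integral>\<^sup>+z. w t * of_bool (norm (z::'a) < t) \<partial>lborel \<partial>lborel)"
    unfolding indicator_def mem_Collect_eq by (intro lborel_pair.Fubini'[symmetric]) measurable
  also have "\<dots> = (\<integral>\<^sup>+t. w t * ennreal (unit_ball_vol (real DIM('a)) * t ^ DIM('a)) * indicator {0..} t \<partial>lborel)"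
  proof (intro nn_integral_cong)
    fix t :: real
    have "(\<integral>\<^sup>+z. w t * of_bool (norm (z::'a) < t) \<partial>lborel) = (\<integral>\<^sup>+z. w t * indicator (ball (0::'a) t) z \<partial>lborel)"
      by (intro nn_integral_cong) (auto simp: indicator_def)
    also have "\<dots> = w t * emeasure lborel (ball (0::'a) t)" by (simp add: nn_integral_cmult_indicator)
    also have "\<dots> = w t * ennreal (unit_ball_vol (real DIM('a)) * t ^ DIM('a)) * indicator {0..} t"
      by (cases "0 \<le> t") (auto simp: emeasure_ball ball_empty)
    finally show "(\<integral>\<^sup>+z. w t * of_bool (norm (z::'a) < t) \<partial>lborel) = \<dots>" .
  qed
  finally show ?thesis .
qed

text \<open>Below \<open>d\<close> the factor \<open>4 * t / d\<close> makes the power integrable at \<open>0\<close>, which uses \<open>s < 1\<close>; above \<open>d\<close> the power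
  itself is integrable at infinity, which uses \<open>0 < s\<close>.\<close>
lemma nn_integral_truncated_power:
  fixes d s :: real
  assumes "0 < d" "0 < s" "s < 1"
  shows "(\<integral>\<^sup>+t. ennreal (min 1 (4 * t / d) * t powr (- (s + 1))) * indicator {0<..} t \<partial>lborel)
       \<le> ennreal ((4 / (1 - s) + 1 / s) * d powr (- s))"
proof -
  have "(\<integral>\<^sup>+t. ennreal (min 1 (4 * t / d) * t powr (- (s + 1))) * indicator {0<..} t \<partial>lborel)
     \<le> (\<integral>\<^sup>+t. ennreal (4 / d) * (ennreal (t powr (- s)) * indicator {0..d} t)
            + ennreal (t powr (- (s + 1))) * indicator {d..} t \<partial>lborel)"
  proof (rule nn_integral_mono)
    fix t :: real
    consider "t \<le> 0" | "0 < t" "t < d" | "d \<le> t" by linarith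
    then show "ennreal (min 1 (4 * t / d) * t powr (- (s + 1))) * indicator {0<..} t \<le>
        ennreal (4 / d) * (ennreal (t powr (- s)) * indicator {0..d} t) + ennreal (t powr (- (s + 1))) * indicator {d..} t"
    proof cases
      case 2
      have "min 1 (4 * t / d) * t powr (- (s + 1)) \<le> (4 * t / d) * t powr (- (s + 1))"
        using 2 by (intro mult_right_mono) auto
      also have "\<dots> = 4 / d * t powr (- s)"
        using 2 by (simp add: powr_diff powr_minus field_simps powr_add)
      finally show ?thesis using 2 \<open>0 < d\<close> by (simp add: ennreal_mult'[symmetric] ennreal_leI)
    next
      case 3
      have "min 1 (4 * t / d) * t powr (- (s + 1)) \<le> 1 * t powr (- (s + 1))"
        by (intro mult_right_mono) auto
      then have "ennreal (min 1 (4 * t / d) * t powr (- (s + 1))) * indicator {0<..} t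
          \<le> ennreal (t powr (- (s + 1))) * indicator {d..} t"
        using 3 \<open>0 < d\<close> by (auto intro: ennreal_leI)
      also have "\<dots> \<le> ennreal (4 / d) * (ennreal (t powr (- s)) * indicator {0..d} t)
          + ennreal (t powr (- (s + 1))) * indicator {d..} t"
        by simp
      finally show ?thesis .
    qed auto
  qed
  also have "\<dots> = ennreal (4 / d) * (\<integral>\<^sup>+t. ennreal (t powr (- s)) * indicator {0..d} t \<partial>lborel)
       + (\<integral>\<^sup>+t. ennreal (t powr (- (s + 1))) * indicator {d..} t \<partial>lborel)"
    by (subst nn_integral_add) (auto simp: nn_integral_cmult)
  also have "(\<integral>\<^sup>+t. ennreal (t powr (- s)) * indicator {0..d} t \<partial>lborel) = ennreal (d powr (- s + 1) / (- s + 1))"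
    using assms by (intro nn_integral_has_integral_lebesgue' has_integral_powr_from_0) auto
  also have "(\<integral>\<^sup>+t. ennreal (t powr (- (s + 1))) * indicator {d..} t \<partial>lborel)
      = ennreal (- (d powr (- (s + 1) + 1)) / (- (s + 1) + 1))"
    using assms by (intro nn_integral_has_integral_lebesgue' has_integral_powr_to_inf) auto
  also have "ennreal (4 / d) * ennreal (d powr (- s + 1) / (- s + 1)) + ennreal (- (d powr (- (s + 1) + 1)) / (- (s + 1) + 1))
     = ennreal ((4 / (1 - s) + 1 / s) * d powr (- s))"
  proof -
    have "d powr (- s + 1) = d * d powr (- s)"
      using assms powr_mult_base[of d "- s"] by (simp add: add.commute)
    then have "4 / d * (d powr (- s + 1) / (- s + 1)) = 4 / (1 - s) * d powr (- s)"
      using assms by (simp add: field_simps)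
    moreover have "- (d powr (- (s + 1) + 1)) / (- (s + 1) + 1) = 1 / s * d powr (- s)"
      using assms by simp
    ultimately show ?thesis
      using assms by (simp add: ennreal_mult'[symmetric] ennreal_plus[symmetric] distrib_right del: ennreal_plus)
  qed
  finally show ?thesis .
qed

text \<open>The truncation by \<open>4 * norm z / d\<close> is the bound for increments of the cutoff functions below at
  distance \<open>d\<close> from the complement. The power \<open>d powr (- s)\<close> is forced by scaling, and it is the one that
  \<open>kernel_of_complement_ge\<close> compares with the kernel integral over the complement.\<close>
lemma nn_integral_truncated_kernel:
  fixes s :: real
  assumes "0 < s" "s < 1"
  obtains C where "0 \<le> C" and "\<And>d. 0 < d \<Longrightarrow>
    (\<integral>\<^sup>+z. ennreal (min 1 (4 * norm z / d)) * frac_kernel s z \<partial>(lborel :: 'a::euclidean_space measure))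
      \<le> ennreal (C * d powr (- s))"
proof
  define n where "n = real DIM('a)"
  define c where "c = 2 powr (n + s + 1) * unit_ball_vol n"
  have "0 \<le> c" by (simp add: c_def n_def)
  show "0 \<le> c * (4 / (1 - s) + 1 / s)" using assms \<open>0 \<le> c\<close> by simp
  fix d :: real assume "0 < d"
  let ?m = "\<lambda>t. min 1 (4 * t / d)"
  \<comment> \<open>The weight is chosen so that its integral over the layers \<open>t\<close> between \<open>r\<close> and \<open>2 * r\<close> already dominates
    the kernel at radius \<open>r\<close>; the factor \<open>2 powr (n + s + 1)\<close> compensates the decay up to \<open>2 * r\<close>.\<close>
  let ?w = "\<lambda>t. ennreal (2 powr (n + s + 1) * ?m t * t powr (- (n + s + 1)))"
  have "ennreal (?m (norm z)) * frac_kernel s z \<le> (\<integral>\<^sup>+t. ?w t * indicator {t. norm z < t} t \<partial>lborel)" for z :: 'a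
  proof (cases "z = 0")
    case False
    define r where "r = norm z"
    have "0 < r" using False by (simp add: r_def)
    have "ennreal (?m r) * frac_kernel s z = ennreal (?m r * r powr (- (n + s)))"
      using \<open>0 < r\<close> \<open>0 < d\<close> unfolding frac_kernel_def r_def[symmetric] n_def powr_minus_divide
      by (simp add: ennreal_mult'[symmetric])
    also have "\<dots> = (\<integral>\<^sup>+t. ennreal (?m r * r powr (- (n + s + 1))) * indicator {r<..<2 * r} t \<partial>lborel)"
    proof -
      have "?m r * r powr (- (n + s)) = ?m r * r powr (- (n + s + 1)) * r"
        using \<open>0 < r\<close> powr_mult_base[of r "- (n + s + 1)"] by (simp add: mult_ac)
      then show ?thesis
        using \<open>0 < r\<close> \<open>0 < d\<close> by (simp add: nn_integral_cmult_indicator ennreal_mult'[symmetric])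
    qed
    also have "\<dots> \<le> (\<integral>\<^sup>+t. ?w t * indicator {t. norm z < t} t \<partial>lborel)"
    proof (rule nn_integral_mono)
      fix t :: real
      show "ennreal (?m r * r powr (- (n + s + 1))) * indicator {r<..<2 * r} t \<le> ?w t * indicator {t. norm z < t} t"
      proof (cases "t \<in> {r<..<2 * r}")
        case True
        have "2 powr (n + s + 1) * 2 powr (- (n + s + 1)) = 1"
          unfolding powr_add[symmetric] by simp
        then have "r powr (- (n + s + 1)) = 2 powr (n + s + 1) * (2 * r) powr (- (n + s + 1))"
          using \<open>0 < r\<close> unfolding powr_mult mult.assoc[symmetric] by simp
        also have "\<dots> \<le> 2 powr (n + s + 1) * t powr (- (n + s + 1))"
          using True \<open>0 < r\<close> \<open>0 < s\<close> by (intro mult_left_mono powr_mono2') (auto simp: n_def)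
        finally have "?m r * r powr (- (n + s + 1)) \<le> ?m t * (2 powr (n + s + 1) * t powr (- (n + s + 1)))"
          using True \<open>0 < r\<close> \<open>0 < d\<close>
          by (intro mult_mono min.mono) (auto intro!: divide_right_mono)
        then show ?thesis using True by (auto simp: r_def[symmetric] mult_ac intro!: ennreal_leI)
      qed auto
    qed
    finally show ?thesis by (simp add: r_def)
  qed (simp add: frac_kernel_def)
  then have "(\<integral>\<^sup>+z. ennreal (?m (norm z)) * frac_kernel s z \<partial>(lborel :: 'a measure))
     \<le> (\<integral>\<^sup>+z. (\<integral>\<^sup>+t. ?w t * indicator {t. norm z < t} t \<partial>lborel) \<partial>(lborel :: 'a measure))"
    by (rule nn_integral_mono)
  also have "\<dots> = (\<integral>\<^sup>+t. ?w t * ennreal (unit_ball_vol (real DIM('a)) * t ^ DIM('a)) * indicator {0..} t \<partial>lborel)"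
    by (rule nn_integral_radial_layers) measurable
  also have "\<dots> = (\<integral>\<^sup>+t. ennreal c * (ennreal (?m t * t powr (- (s + 1))) * indicator {0<..} t) \<partial>lborel)"
  proof (rule nn_integral_cong)
    fix t :: real
    show "?w t * ennreal (unit_ball_vol (real DIM('a)) * t ^ DIM('a)) * indicator {0..} t
       = ennreal c * (ennreal (?m t * t powr (- (s + 1))) * indicator {0<..} t)"
    proof (cases "0 < t")
      case True
      have "t powr (- (n + s + 1)) * t ^ DIM('a) = t powr (- (s + 1))"
        using True by (simp add: powr_realpow[symmetric] powr_add[symmetric] n_def)
      then have "2 powr (n + s + 1) * ?m t * t powr (- (n + s + 1)) * (unit_ball_vol (real DIM('a)) * t ^ DIM('a))
          = c * (?m t * t powr (- (s + 1)))"
        by (simp add: c_def n_def mult_ac)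
      then show ?thesis
        using True \<open>0 < d\<close> \<open>0 \<le> c\<close> by (simp add: ennreal_mult'[symmetric])
    qed (auto simp: indicator_def)
  qed
  also have "\<dots> = ennreal c * (\<integral>\<^sup>+t. ennreal (?m t * t powr (- (s + 1))) * indicator {0<..} t \<partial>lborel)"
    by (rule nn_integral_cmult) measurable
  also have "\<dots> \<le> ennreal c * ennreal ((4 / (1 - s) + 1 / s) * d powr (- s))"
    using nn_integral_truncated_power[OF \<open>0 < d\<close> assms] by (rule mult_left_mono) simp
  also have "\<dots> = ennreal (c * (4 / (1 - s) + 1 / s) * d powr (- s))"
    using \<open>0 \<le> c\<close> by (simp add: ennreal_mult'[symmetric] mult.assoc)
  finally show "(\<integral>\<^sup>+z. ennreal (?m (norm z)) * frac_kernel s z \<partial>(lborel :: 'a measure))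
      \<le> ennreal (c * (4 / (1 - s) + 1 / s) * d powr (- s))" .
qed

text \<open>On or below the graph of an \<open>L\<close>-Lipschitz function every point is the apex of a cone that points along
  \<open>- e\<close>, stays on or below the graph and has an aperture depending on \<open>L\<close> alone. Such a cone contains
  balls of radius proportional to the distance from its apex.\<close>
lemma exterior_ball_local:
  fixes \<Omega> :: "'a::euclidean_space set"
  assumes "open \<Omega>" and e: "norm e = 1" and "0 < r" and g: "L-lipschitz_on {y. y \<bullet> e = 0} g"
    and graph: "\<And>x. x \<in> ball p r \<Longrightarrow> x \<in> \<Omega> \<longleftrightarrow> g (x - (x \<bullet> e) *\<^sub>R e) < x \<bullet> e"
    and q: "q \<in> frontier \<Omega>" "q \<in> ball p (r / 2)" and t: "0 < t" "t \<le> r / 2"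
  shows "ball (q - (t / 2) *\<^sub>R e) (t / (4 * (1 + L))) \<subseteq> ball q t - \<Omega>"
proof
  have ee: "e \<bullet> e = 1" using e by (simp add: norm_eq_1)
  have "0 \<le> L" using g by (rule lipschitz_on_nonneg)
  fix x assume x: "x \<in> ball (q - (t / 2) *\<^sub>R e) (t / (4 * (1 + L)))"
  \<comment> \<open>The deviation of \<open>x\<close> from the centre of the ball, which lies at depth \<open>t / 2\<close> below \<open>q\<close>, and the
    projection to the hyperplane on which the chart is defined.\<close>
  define v where "v = q - (t / 2) *\<^sub>R e - x"
  define P where "P = (\<lambda>y::'a. y - (y \<bullet> e) *\<^sub>R e)"
  have x_eq: "x = q - (t / 2) *\<^sub>R e - v" by (simp add: v_def)
  have v: "norm v < t / (4 * (1 + L))" using x by (simp add: v_def dist_norm)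
  have ve: "\<bar>v \<bullet> e\<bar> \<le> norm v" using Cauchy_Schwarz_ineq2[of v e] e by simp
  have Pv: "norm (P v) \<le> 2 * norm v"
    using norm_triangle_ineq4[of v "(v \<bullet> e) *\<^sub>R e"] ve e by (simp add: P_def)
  have "t / (4 * (1 + L)) * (1 + 2 * L) \<le> t / (4 * (1 + L)) * (2 * (1 + L))"
    using t \<open>0 \<le> L\<close> by (intro mult_left_mono) auto
  also have "\<dots> = t / 2" using \<open>0 \<le> L\<close> by (simp add: field_simps)
  finally have half: "t / (4 * (1 + L)) * (1 + 2 * L) \<le> t / 2" .
  have small: "norm v * (1 + 2 * L) \<le> t / (4 * (1 + L)) * (1 + 2 * L)"
    using v \<open>0 \<le> L\<close> by (intro mult_right_mono) auto
  have "norm v < t / 2"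
  proof -
    have "norm v * 1 \<le> norm v * (1 + 2 * L)" using \<open>0 \<le> L\<close> by (intro mult_left_mono) auto
    moreover have "norm v * (1 + 2 * L) < t / (4 * (1 + L)) * (1 + 2 * L)"
      using v \<open>0 \<le> L\<close> by (intro mult_strict_right_mono) auto
    ultimately show ?thesis using half by linarith
  qed
  moreover have "q - x = (t / 2) *\<^sub>R e + v" by (simp add: x_eq)
  ultimately have qx: "norm (q - x) < t"
    using norm_triangle_ineq[of "(t / 2) *\<^sub>R e" v] e t by simp
  then have "x \<in> ball q t" by (simp add: dist_norm)
  moreover have "x \<notin> \<Omega>"
  proof -
    have qp: "q \<in> ball p r" using q(2) \<open>0 < r\<close> by simp
    have "dist p x \<le> dist p q + dist q x" by (rule dist_triangle)
    then have xp: "x \<in> ball p r" using q(2) qx t by (simp add: dist_norm)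
    have "q \<notin> \<Omega>" using q(1) \<open>open \<Omega>\<close> by (simp add: frontier_def interior_open)
    then have gq: "q \<bullet> e \<le> g (P q)" using graph[OF qp] by (simp add: P_def)
    have P0: "P y \<bullet> e = 0" for y by (simp add: P_def inner_diff_left ee)
    have PP: "P q - P x = P v"
      by (simp add: P_def x_eq inner_diff_left ee algebra_simps)
    have "dist (g (P q)) (g (P x)) \<le> L * dist (P q) (P x)"
      using lipschitz_onD[OF g, of "P q" "P x"] P0 by simp
    also have "\<dots> \<le> L * (2 * norm v)"
      using Pv \<open>0 \<le> L\<close> by (intro mult_left_mono) (auto simp: dist_norm PP)
    finally have "g (P q) - L * (2 * norm v) \<le> g (P x)" by (simp add: dist_real_def)
    moreover have "x \<bullet> e = q \<bullet> e - t / 2 - v \<bullet> e" by (simp add: x_eq inner_diff_left ee)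
    moreover have "norm v + 2 * L * norm v \<le> t / 2" using order_trans[OF small half] by (simp add: algebra_simps)
    ultimately have "x \<bullet> e \<le> g (P x)" using gq ve by (simp add: algebra_simps)
    then show ?thesis using graph[OF xp] by (simp add: P_def)
  qed
  ultimately show "x \<in> ball q t - \<Omega>" by simp
qed

text \<open>The constants of the local charts are made uniform by compactness of the boundary.\<close>
lemma exterior_ball_condition:
  fixes \<Omega> :: "'a::euclidean_space set"
  assumes "open \<Omega>" "bounded \<Omega>" "lipschitz_boundary \<Omega>"
  obtains c r where "0 < c" "0 < r"
    "\<And>q t. q \<in> frontier \<Omega> \<Longrightarrow> 0 < t \<Longrightarrow> t \<le> r \<Longrightarrow> \<exists>z. ball z (c * t) \<subseteq> ball q t - \<Omega>"
proof -
  have "\<exists>c r. 0 < c \<and> 0 < r \<and> (\<forall>q\<in>frontier \<Omega> \<inter> ball p r. \<forall>t. 0 < t \<and> t \<le> r \<longrightarrow>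
      (\<exists>z. ball z (c * t) \<subseteq> ball q t - \<Omega>))" if "p \<in> frontier \<Omega>" for p
  proof -
    obtain e r L and g :: "'a \<Rightarrow> real" where *: "norm e = 1" "0 < r" "L-lipschitz_on {y. y \<bullet> e = 0} g"
      "\<And>x. x \<in> ball p r \<Longrightarrow> x \<in> \<Omega> \<longleftrightarrow> g (x - (x \<bullet> e) *\<^sub>R e) < x \<bullet> e"
      using assms(3) \<open>p \<in> frontier \<Omega>\<close> unfolding lipschitz_boundary_def by metis
    have "0 \<le> L" using *(3) by (rule lipschitz_on_nonneg)
    show ?thesis
    proof (rule exI[of _ "1 / (4 * (1 + L))"], rule exI[of _ "r / 2"], intro conjI ballI allI impI)
      fix q t assume "q \<in> frontier \<Omega> \<inter> ball p (r / 2)" "0 < t \<and> t \<le> r / 2"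
      then show "\<exists>z. ball z (1 / (4 * (1 + L)) * t) \<subseteq> ball q t - \<Omega>"
        using exterior_ball_local[OF \<open>open \<Omega>\<close> *, where q = q and t = t] by auto
    qed (use *(2) \<open>0 \<le> L\<close> in auto)
  qed
  then obtain c r where cr: "\<And>p. p \<in> frontier \<Omega> \<Longrightarrow> 0 < c p" "\<And>p. p \<in> frontier \<Omega> \<Longrightarrow> 0 < r p"
    "\<And>p q t. p \<in> frontier \<Omega> \<Longrightarrow> q \<in> frontier \<Omega> \<Longrightarrow> q \<in> ball p (r p) \<Longrightarrow> 0 < t \<Longrightarrow> t \<le> r p \<Longrightarrow>
      \<exists>z. ball z (c p * t) \<subseteq> ball q t - \<Omega>"
    by (metis IntI)
  have "compact (frontier \<Omega>)" using \<open>bounded \<Omega>\<close> by (rule compact_frontier_bounded)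
  moreover have "frontier \<Omega> \<subseteq> (\<Union>p\<in>frontier \<Omega>. ball p (r p))" using cr(2) by force
  ultimately obtain F where F: "F \<subseteq> frontier \<Omega>" "finite F" "frontier \<Omega> \<subseteq> (\<Union>p\<in>F. ball p (r p))"
    using compactE_image[of "frontier \<Omega>" "frontier \<Omega>" "\<lambda>p. ball p (r p)"] by auto
  define c0 where "c0 = Min (insert 1 (c ` F))"
  define r0 where "r0 = Min (insert 1 (r ` F))"
  have "0 < c0" "0 < r0" unfolding c0_def r0_def using F cr(1,2) by (auto simp: Min_gr_iff)
  moreover have "\<exists>z. ball z (c0 * t) \<subseteq> ball q t - \<Omega>" if q: "q \<in> frontier \<Omega>" "0 < t" "t \<le> r0" for q t
  proof -
    obtain p where p: "p \<in> F" "q \<in> ball p (r p)" using F(3) q(1) by auto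
    have "c0 \<le> c p" "r0 \<le> r p" unfolding c0_def r0_def using F(2) p(1) by auto
    then obtain z where "ball z (c p * t) \<subseteq> ball q t - \<Omega>"
      using cr(3)[of p q t] p q F(1) by auto
    moreover have "ball z (c0 * t) \<subseteq> ball z (c p * t)"
      using \<open>c0 \<le> c p\<close> q by (intro subset_ball mult_right_mono) auto
    ultimately show ?thesis by blast
  qed
  ultimately show thesis by (rule that)
qed

text \<open>The open ball about \<open>y\<close> that reaches up to the nearest point of the complement lies in \<open>\<Omega>\<close>, so this
  point is in the closure of \<open>\<Omega>\<close>.\<close>
lemma nearest_point_in_frontier:
  fixes \<Omega> :: "'a::euclidean_space set"
  assumes "open \<Omega>" "bounded \<Omega>" "y \<in> \<Omega>"
  obtains q where "q \<in> frontier \<Omega>" "infdist y (- \<Omega>) = dist y q" "0 < infdist y (- \<Omega>)"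
proof -
  have ne: "- \<Omega> \<noteq> {}" using \<open>bounded \<Omega>\<close> not_bounded_UNIV by (metis Compl_empty_eq double_compl)
  obtain q where q: "q \<in> - \<Omega>" "infdist y (- \<Omega>) = dist y q"
    using infdist_attains_inf[of "- \<Omega>" y] \<open>open \<Omega>\<close> ne by (auto simp: closed_Compl)
  have pos: "0 < dist y q" using q(1) \<open>y \<in> \<Omega>\<close> by auto
  have "ball y (dist y q) \<subseteq> \<Omega>"
    using infdist_le[of _ "- \<Omega>" y] q(2) by fastforce
  then have "closure (ball y (dist y q)) \<subseteq> closure \<Omega>" by (rule closure_mono)
  then have "q \<in> closure \<Omega>" using pos by auto
  then have "q \<in> frontier \<Omega>" using q(1) \<open>open \<Omega>\<close> by (simp add: frontier_def interior_open)
  then show thesis using that q(2) pos by simp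
qed

text \<open>Near the boundary point closest to \<open>y\<close> the complement contains a ball whose radius is comparable with
  the distance of \<open>y\<close> to the complement and whose points are at most twice that distance away from \<open>y\<close>.
  This is the fractional Hardy inequality in the only form needed: for \<open>A \<subseteq> \<Omega>\<close>, integrating over \<open>A\<close>
  bounds the integral of the power of the distance by the fractional perimeter of \<open>A\<close>.\<close>
lemma kernel_of_complement_ge:
  fixes \<Omega> :: "'a::euclidean_space set" and s :: real
  assumes "open \<Omega>" "bounded \<Omega>" "lipschitz_boundary \<Omega>" "0 < s"
  obtains \<kappa> where "0 < \<kappa>" and "\<And>y. y \<in> \<Omega> \<Longrightarrow>
    ennreal (\<kappa> * infdist y (- \<Omega>) powr (- s))
      \<le> (\<integral>\<^sup>+x. indicator (- \<Omega>) x * frac_kernel s (y - x) \<partial>lborel)"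
proof -
  obtain c r where cr: "0 < c" "0 < r"
    "\<And>q t. q \<in> frontier \<Omega> \<Longrightarrow> 0 < t \<Longrightarrow> t \<le> r \<Longrightarrow> \<exists>z. ball z (c * t) \<subseteq> ball q t - \<Omega>"
    using exterior_ball_condition[OF assms(1-3)] by blast
  have ne: "- \<Omega> \<noteq> {}" using \<open>bounded \<Omega>\<close> not_bounded_UNIV by (metis Compl_empty_eq double_compl)
  then obtain a where a: "a \<in> - \<Omega>" by blast
  obtain M where M: "\<And>y. y \<in> \<Omega> \<Longrightarrow> dist y a \<le> M"
    using \<open>bounded \<Omega>\<close> by (metis bounded_any_center dist_commute)
  define D where "D = max M 1"
  have D: "0 < D" "\<And>y. y \<in> \<Omega> \<Longrightarrow> infdist y (- \<Omega>) \<le> D"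
    using infdist_le[OF a] M unfolding D_def by (auto intro: order_trans max.coboundedI1)
  \<comment> \<open>Exterior balls are available up to scale \<open>r\<close> only; shrinking all distances, which are at most \<open>D\<close>, by
    the factor \<open>\<theta>\<close> brings them into that range.\<close>
  define \<theta> where "\<theta> = min 1 (r / D)"
  have \<theta>: "0 < \<theta>" "\<theta> \<le> 1" using cr D by (auto simp: \<theta>_def)
  define n where "n = real DIM('a)"
  define \<kappa> where "\<kappa> = unit_ball_vol n * (c * \<theta>) ^ DIM('a) * 2 powr (- (n + s))"
  have "0 < \<kappa>" unfolding \<kappa>_def using cr \<theta> by (simp add: n_def)
  moreover have "ennreal (\<kappa> * infdist y (- \<Omega>) powr (- s))
      \<le> (\<integral>\<^sup>+x. indicator (- \<Omega>) x * frac_kernel s (y - x) \<partial>lborel)" if y: "y \<in> \<Omega>" for y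
  proof -
    obtain q where q: "q \<in> frontier \<Omega>" "infdist y (- \<Omega>) = dist y q" "0 < infdist y (- \<Omega>)"
      using nearest_point_in_frontier[OF assms(1,2) y] .
    define d where "d = infdist y (- \<Omega>)"
    have d: "0 < d" "d = dist y q" "d \<le> D" using q D(2)[OF y] by (auto simp: d_def)
    have "\<theta> * d \<le> r / D * D" unfolding \<theta>_def using d D cr by (intro mult_mono) auto
    then have "\<theta> * d \<le> r" using D by simp
    then obtain z where z: "ball z (c * (\<theta> * d)) \<subseteq> ball q (\<theta> * d) - \<Omega>"
      using cr(3)[OF q(1), of "\<theta> * d"] d \<theta> by auto
    have "\<kappa> * d powr (- s) = (2 * d) powr (- (n + s)) * (unit_ball_vol n * (c * (\<theta> * d)) ^ DIM('a))"
    proof -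
      have "d powr (- s) = d powr (- (n + s)) * d ^ DIM('a)"
        using d by (simp add: powr_realpow[symmetric] powr_add[symmetric] n_def)
      then show ?thesis using d by (simp add: \<kappa>_def powr_mult power_mult_distrib mult_ac)
    qed
    then have "ennreal (\<kappa> * d powr (- s))
        = ennreal ((2 * d) powr (- (n + s))) * emeasure lborel (ball z (c * (\<theta> * d)))"
      using cr \<theta> d by (simp add: emeasure_ball n_def ennreal_mult')
    also have "\<dots> = (\<integral>\<^sup>+x. ennreal ((2 * d) powr (- (n + s))) * indicator (ball z (c * (\<theta> * d))) x \<partial>lborel)"
      by (simp add: nn_integral_cmult_indicator)
    also have "\<dots> \<le> (\<integral>\<^sup>+x. indicator (- \<Omega>) x * frac_kernel s (y - x) \<partial>lborel)"
    proof (rule nn_integral_mono)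
      fix x
      show "ennreal ((2 * d) powr (- (n + s))) * indicator (ball z (c * (\<theta> * d))) x
          \<le> indicator (- \<Omega>) x * frac_kernel s (y - x)"
      proof (cases "x \<in> ball z (c * (\<theta> * d))")
        case True
        then have x: "dist q x < \<theta> * d" "x \<notin> \<Omega>" using z by auto
        have "\<theta> * d \<le> 1 * d" using \<theta> d by (intro mult_right_mono) auto
        moreover have "dist y x \<le> dist y q + dist q x" by (rule dist_triangle)
        ultimately have "norm (y - x) \<le> 2 * d" using x d(2) unfolding dist_norm by linarith
        moreover have "0 < norm (y - x)" using x y by auto
        ultimately have "(2 * d) powr (- (n + s)) \<le> norm (y - x) powr (- (n + s))"
          using \<open>0 < s\<close> by (intro powr_mono2') (auto simp: n_def)
        also have "\<dots> = 1 / norm (y - x) powr (n + s)" by (rule powr_minus_divide)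
        finally show ?thesis using True x by (simp add: frac_kernel_def n_def ennreal_leI)
      qed auto
    qed
    finally show ?thesis by (simp add: d_def)
  qed
  ultimately show thesis by (rule that)
qed

section \<open>Cutting off near the boundary\<close>

text \<open>For \<open>k > 0\<close>: zero at distance at most \<open>1 / k\<close> from the complement, one at distance at least \<open>2 / k\<close>.\<close>
definition cutoff :: "'a::euclidean_space set \<Rightarrow> nat \<Rightarrow> 'a \<Rightarrow> real" where
  "cutoff \<Omega> k x = min 1 (max 0 (real k * infdist x (- \<Omega>) - 1))"

lemma cutoff_measurable [measurable]: "cutoff \<Omega> k \<in> borel_measurable borel"
proof -
  have "continuous_on UNIV (cutoff \<Omega> k)"
    unfolding cutoff_def[abs_def] by (intro continuous_intros)
  then show ?thesis by (rule borel_measurable_continuous_onI)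
qed

lemma cutoff_bounds: "0 \<le> cutoff \<Omega> k x" "cutoff \<Omega> k x \<le> 1"
  by (auto simp: cutoff_def)

text \<open>The bound must not depend on the slope \<open>k\<close>. The slope is felt only where \<open>k * a\<close> or \<open>k * b\<close> is below \<open>2\<close>.
  If \<open>a\<close> and \<open>b\<close> are comparable there, then \<open>k\<close> is at most \<open>4 / b\<close>; if they are not, then \<open>r\<close> is already
  comparable with \<open>b\<close> and the trivial bound \<open>1\<close> suffices.\<close>
lemma truncation_difference_le:
  fixes a b k r :: real
  assumes "0 \<le> a" "0 < b" "0 \<le> k" "\<bar>a - b\<bar> \<le> r"
  shows "\<bar>min 1 (max 0 (k * a - 1)) - min 1 (max 0 (k * b - 1))\<bar> \<le> 4 * r / b"
proof -
  let ?D = "\<bar>min 1 (max 0 (k * a - 1)) - min 1 (max 0 (k * b - 1))\<bar>"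
  have lip: "?D \<le> \<bar>k * a - k * b\<bar>" and one: "?D \<le> 1" by (auto simp: min_def max_def)
  consider "2 \<le> k * a" "2 \<le> k * b" | "a < b / 2" | "b / 2 \<le> a" "k * a < 2 \<or> k * b < 2" by linarith
  then show ?thesis
  proof cases
    case 1
    then have "?D = 0" by simp
    then show ?thesis using assms by (simp add: divide_nonneg_pos)
  next
    case 2
    then have "b \<le> 4 * r" using assms by linarith
    then have "1 \<le> 4 * r / b" using \<open>0 < b\<close> by simp
    then show ?thesis using one by linarith
  next
    case 3
    have "k * b \<le> 4"
    proof (cases "k * b < 2")
      case False
      then have "k * a < 2" using 3 by auto
      moreover have "k * (b / 2) \<le> k * a" using 3 assms by (intro mult_left_mono) auto
      ultimately show ?thesis by simp
    qed simp
    then have "k \<le> 4 / b" using \<open>0 < b\<close> by (simp add: field_simps)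
    have "\<bar>k * a - k * b\<bar> = k * \<bar>a - b\<bar>"
      using \<open>0 \<le> k\<close> by (simp add: right_diff_distrib[symmetric] abs_mult)
    also have "\<dots> \<le> 4 / b * r" using \<open>k \<le> 4 / b\<close> assms by (intro mult_mono) auto
    finally show ?thesis using lip by simp
  qed
qed

lemma cutoff_difference_le:
  assumes "0 < infdist y (- \<Omega>)"
  shows "\<bar>cutoff \<Omega> k x - cutoff \<Omega> k y\<bar> \<le> min 1 (4 * norm (x - y) / infdist y (- \<Omega>))"
proof -
  have "\<bar>cutoff \<Omega> k x - cutoff \<Omega> k y\<bar> \<le> 4 * norm (x - y) / infdist y (- \<Omega>)"
    unfolding cutoff_def using assms infdist_triangle_abs[of x "- \<Omega>" y]
    by (intro truncation_difference_le) (auto simp: dist_norm infdist_nonneg)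
  moreover have "\<bar>cutoff \<Omega> k x - cutoff \<Omega> k y\<bar> \<le> 1"
    using cutoff_bounds[of \<Omega> k x] cutoff_bounds[of \<Omega> k y] by linarith
  ultimately show ?thesis by simp
qed

lemma cutoff_eventually_one:
  assumes "0 < infdist x (- \<Omega>)"
  shows "\<forall>\<^sub>F k in sequentially. cutoff \<Omega> k x = 1"
proof -
  obtain N :: nat where N: "2 / infdist x (- \<Omega>) \<le> real N" using real_arch_simple by blast
  have "cutoff \<Omega> k x = 1" if "N \<le> k" for k
  proof -
    have "2 / infdist x (- \<Omega>) \<le> real k" using N that by linarith
    then show ?thesis using assms by (simp add: cutoff_def field_simps)
  qed
  then show ?thesis unfolding eventually_sequentially by blast
qed

text \<open>A pair of points with one point in \<open>A\<close> and the other outside contributes at most what it contributes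
  to the perimeter, because \<open>0 \<le> \<eta> \<le> 1\<close>; only pairs inside \<open>A\<close> see the variation of \<open>\<eta>\<close>.\<close>
lemma gagliardo_cutoff_le:
  fixes A :: "'a::euclidean_space set" and \<eta> :: "'a \<Rightarrow> real"
  assumes [measurable]: "A \<in> sets borel" "\<eta> \<in> borel_measurable borel"
    and \<eta>: "\<And>x. 0 \<le> \<eta> x" "\<And>x. \<eta> x \<le> 1"
  shows "gagliardo s UNIV (\<lambda>x. \<eta> x * indicator A x) \<le> gagliardo s UNIV (indicator A) +
    (\<integral>\<^sup>+y. indicator A y *
       (\<integral>\<^sup>+x. indicator A x * ennreal \<bar>\<eta> x - \<eta> y\<bar> * frac_kernel s (x - y) \<partial>lborel) \<partial>lborel)"
proof -
  let ?h = "\<lambda>y x. indicator A x * ennreal \<bar>\<eta> x - \<eta> y\<bar> * frac_kernel s (x - y)"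
  let ?i = "\<lambda>y x. ennreal \<bar>indicator A y - indicator A x :: real\<bar> * frac_kernel s (y - x)"
  have "gagliardo s UNIV (\<lambda>x. \<eta> x * indicator A x)
      \<le> (\<integral>\<^sup>+y. (\<integral>\<^sup>+x. ?i y x + indicator A y * ?h y x \<partial>lborel) \<partial>lborel)"
    unfolding gagliardo_UNIV
  proof (intro nn_integral_mono)
    fix y x
    have "\<bar>\<eta> y * indicator A y - \<eta> x * indicator A x\<bar>
        \<le> \<bar>indicator A y - indicator A x\<bar> + indicator A y * (indicator A x * \<bar>\<eta> x - \<eta> y\<bar>)"
      using \<eta>[of x] \<eta>[of y] by (auto simp: indicator_def)
    then have "ennreal \<bar>\<eta> y * indicator A y - \<eta> x * indicator A x\<bar> \<le>
        ennreal (\<bar>indicator A y - indicator A x\<bar> + indicator A y * (indicator A x * \<bar>\<eta> x - \<eta> y\<bar>))"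
      by (rule ennreal_leI)
    also have "\<dots> = ennreal \<bar>indicator A y - indicator A x :: real\<bar>
        + indicator A y * (indicator A x * ennreal \<bar>\<eta> x - \<eta> y\<bar>)"
      by (auto simp: indicator_def)
    finally have "ennreal \<bar>\<eta> y * indicator A y - \<eta> x * indicator A x\<bar> * frac_kernel s (y - x)
       \<le> (ennreal \<bar>indicator A y - indicator A x :: real\<bar>
          + indicator A y * (indicator A x * ennreal \<bar>\<eta> x - \<eta> y\<bar>)) * frac_kernel s (y - x)"
      by (rule mult_right_mono) simp
    then show "ennreal \<bar>\<eta> y * indicator A y - \<eta> x * indicator A x\<bar> * frac_kernel s (y - x)
        \<le> ?i y x + indicator A y * ?h y x"
      by (simp add: distrib_left distrib_right mult_ac frac_kernel_minus[of s y x])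
  qed
  also have "\<dots> = (\<integral>\<^sup>+y. (\<integral>\<^sup>+x. ?i y x \<partial>lborel) + indicator A y * (\<integral>\<^sup>+x. ?h y x \<partial>lborel) \<partial>lborel)"
    by (simp add: nn_integral_add nn_integral_cmult)
  also have "\<dots> = (\<integral>\<^sup>+y. (\<integral>\<^sup>+x. ?i y x \<partial>lborel) \<partial>lborel)
       + (\<integral>\<^sup>+y. indicator A y * (\<integral>\<^sup>+x. ?h y x \<partial>lborel) \<partial>lborel)"
    by (intro nn_integral_add) measurable
  finally show ?thesis unfolding gagliardo_UNIV .
qed

text \<open>Dominated convergence, first in \<open>x\<close> and then in \<open>y\<close>. The increments of the cutoffs are bounded
  independently of \<open>k\<close>, which leaves the power \<open>- s\<close> of the distance to the complement after the inner
  integration; by the Hardy-type bound this is controlled by the interaction of \<open>y\<close> with the complement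
  of \<open>\<Omega>\<close>, a part of the finite perimeter of \<open>A\<close>.\<close>
lemma cutoff_error_tendsto_0:
  fixes A :: "'a::euclidean_space set" and s :: real
  assumes "open \<Omega>" "bounded \<Omega>" "lipschitz_boundary \<Omega>" and s: "0 < s" "s < 1"
    and A [measurable]: "A \<in> sets borel" and "A \<subseteq> \<Omega>" and fin: "gagliardo s UNIV (indicator A) < \<infinity>"
  shows "(\<lambda>k. \<integral>\<^sup>+y. indicator A y * (\<integral>\<^sup>+x. indicator A x *
      ennreal \<bar>cutoff \<Omega> k x - cutoff \<Omega> k y\<bar> * frac_kernel s (x - y) \<partial>lborel) \<partial>lborel) \<longlonglongrightarrow> 0"
proof -
  have [measurable]: "\<Omega> \<in> sets borel" using \<open>open \<Omega>\<close> by simp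
  obtain C where C: "0 \<le> C" "\<And>d. 0 < d \<Longrightarrow>
    (\<integral>\<^sup>+z. ennreal (min 1 (4 * norm z / d)) * frac_kernel s z \<partial>(lborel :: 'a measure))
      \<le> ennreal (C * d powr (- s))"
    using nn_integral_truncated_kernel[OF s] by blast
  obtain \<kappa> where \<kappa>: "0 < \<kappa>" "\<And>y. y \<in> \<Omega> \<Longrightarrow> ennreal (\<kappa> * infdist y (- \<Omega>) powr (- s))
      \<le> (\<integral>\<^sup>+x. indicator (- \<Omega>) x * frac_kernel s (y - x) \<partial>lborel)"
    using kernel_of_complement_ge[OF assms(1-3) s(1)] by blast
  have dpos: "0 < infdist y (- \<Omega>)" if "y \<in> A" for y
    using nearest_point_in_frontier[OF assms(1,2), of y] that \<open>A \<subseteq> \<Omega>\<close> by blast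
  let ?h = "\<lambda>k y x. indicator A x * ennreal \<bar>cutoff \<Omega> k x - cutoff \<Omega> k y\<bar> * frac_kernel s (x - y)"
  let ?g = "\<lambda>y x. ennreal (min 1 (4 * norm (x - y) / infdist y (- \<Omega>))) * frac_kernel s (x - y)"
  have hg: "?h k y x \<le> ?g y x" if "y \<in> A" for k y x
    using cutoff_difference_le[OF dpos[OF that], of k x]
    by (auto simp: indicator_def intro!: mult_right_mono ennreal_leI)
  have g_int: "(\<integral>\<^sup>+x. ?g y x \<partial>lborel) \<le> ennreal (C * infdist y (- \<Omega>) powr (- s))" if "y \<in> A" for y
    using nn_integral_lborel_translate[of "\<lambda>x. ?g y x" y] C(2)[OF dpos[OF that]] by simp
  have inner: "(\<lambda>k. \<integral>\<^sup>+x. ?h k y x \<partial>lborel) \<longlonglongrightarrow> 0" if "y \<in> A" for y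
  proof -
    have "(\<lambda>k. \<integral>\<^sup>+x. ?h k y x \<partial>lborel) \<longlonglongrightarrow> (\<integral>\<^sup>+x. 0 \<partial>(lborel :: 'a measure))"
    proof (rule nn_integral_dominated_convergence[where w = "?g y"])
      show "AE x in lborel. ?h k y x \<le> ?g y x" for k using hg[OF that] by simp
      show "(\<integral>\<^sup>+x. ?g y x \<partial>lborel) < \<infinity>"
        using g_int[OF that] by (rule le_less_trans) simp
      show "AE x in lborel. (\<lambda>k. ?h k y x) \<longlonglongrightarrow> 0"
      proof (rule AE_I2)
        fix x
        show "(\<lambda>k. ?h k y x) \<longlonglongrightarrow> 0"
        proof (cases "x \<in> A")
          case True
          have "\<forall>\<^sub>F k in sequentially. ?h k y x = 0"
            using cutoff_eventually_one[OF dpos[OF that]] cutoff_eventually_one[OF dpos[OF True]]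
            by eventually_elim simp
          then show ?thesis by (rule tendsto_eventually)
        qed simp
      qed
    qed measurable
    then show ?thesis by simp
  qed
  let ?w = "\<lambda>y. ennreal (C / \<kappa>) * (\<integral>\<^sup>+x. ennreal \<bar>indicator A y - indicator A x :: real\<bar> * frac_kernel s (y - x) \<partial>lborel)"
  have outer_bound: "indicator A y * (\<integral>\<^sup>+x. ?h k y x \<partial>lborel) \<le> ?w y" for k y
  proof (cases "y \<in> A")
    case True
    have "(\<integral>\<^sup>+x. ?h k y x \<partial>lborel) \<le> (\<integral>\<^sup>+x. ?g y x \<partial>lborel)"
      using hg[OF True] by (rule nn_integral_mono)
    also have "\<dots> \<le> ennreal (C * infdist y (- \<Omega>) powr (- s))" using True by (rule g_int)
    also have "\<dots> = ennreal (C / \<kappa>) * ennreal (\<kappa> * infdist y (- \<Omega>) powr (- s))"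
      using C(1) \<kappa>(1) by (simp add: ennreal_mult'[symmetric])
    also have "\<dots> \<le> ennreal (C / \<kappa>) * (\<integral>\<^sup>+x. indicator (- \<Omega>) x * frac_kernel s (y - x) \<partial>lborel)"
      using \<kappa>(2)[of y] True \<open>A \<subseteq> \<Omega>\<close> by (intro mult_left_mono) auto
    also have "\<dots> \<le> ?w y"
      using True \<open>A \<subseteq> \<Omega>\<close> by (intro mult_left_mono nn_integral_mono) (auto simp: indicator_def)
    finally show ?thesis using True by simp
  qed simp
  have "(\<lambda>k. \<integral>\<^sup>+y. indicator A y * (\<integral>\<^sup>+x. ?h k y x \<partial>lborel) \<partial>lborel) \<longlonglongrightarrow> (\<integral>\<^sup>+y. 0 \<partial>(lborel :: 'a measure))"
  proof (rule nn_integral_dominated_convergence[where w = ?w])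
    show "AE y in lborel. indicator A y * (\<integral>\<^sup>+x. ?h k y x \<partial>lborel) \<le> ?w y" for k
      using outer_bound by simp
    have "(\<integral>\<^sup>+y. ?w y \<partial>lborel) = ennreal (C / \<kappa>) * gagliardo s UNIV (indicator A)"
      unfolding gagliardo_UNIV by (rule nn_integral_cmult) measurable
    also have "\<dots> < \<infinity>" using fin by (simp add: ennreal_mult_less_top)
    finally show "(\<integral>\<^sup>+y. ?w y \<partial>lborel) < \<infinity>" .
    show "AE y in lborel. (\<lambda>k. indicator A y * (\<integral>\<^sup>+x. ?h k y x \<partial>lborel)) \<longlonglongrightarrow> 0"
    proof (rule AE_I2)
      fix y show "(\<lambda>k. indicator A y * (\<integral>\<^sup>+x. ?h k y x \<partial>lborel)) \<longlonglongrightarrow> 0"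
        using inner[of y] by (cases "y \<in> A") auto
    qed
  qed measurable
  then show ?thesis by simp
qed

section \<open>Smooth approximation\<close>

lemma integrable_bounded_support:
  fixes u :: "'a::euclidean_space \<Rightarrow> real"
  assumes [measurable]: "u \<in> borel_measurable borel"
    and "bounded \<Omega>" "\<And>x. x \<notin> \<Omega> \<Longrightarrow> u x = 0" "\<And>x. \<bar>u x\<bar> \<le> B"
  shows "integrable lborel u"
proof -
  obtain r where "\<forall>x\<in>\<Omega>. norm x \<le> r" using \<open>bounded \<Omega>\<close> bounded_iff by blast
  then have r: "\<Omega> \<subseteq> cball 0 r" by auto
  show ?thesis
  proof (rule Bochner_Integration.integrable_bound)
    show "integrable lborel (\<lambda>x. indicator (cball (0::'a) r) x *\<^sub>R B)"
      using emeasure_lborel_cball_finite[of "0::'a" r] by (intro integrable_scaleR_left) simp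
    have "\<bar>u x\<bar> \<le> \<bar>indicator (cball 0 r) x * B\<bar>" for x
      using assms(3)[of x] assms(4)[of x] r by (cases "x \<in> \<Omega>") (auto simp: indicator_def)
    then show "AE x in lborel. norm (u x) \<le> norm (indicator (cball 0 r) x *\<^sub>R B)" by simp
  qed measurable
qed

lemma abs_correlate_le:
  fixes \<rho> u :: "'a::euclidean_space \<Rightarrow> real"
  assumes [measurable]: "\<rho> \<in> borel_measurable borel" "u \<in> borel_measurable borel"
    and \<rho>: "\<And>z. 0 \<le> \<rho> z" "(\<integral>\<^sup>+z. ennreal (\<rho> z) \<partial>lborel) = 1" and u: "\<And>x. \<bar>u x\<bar> \<le> B"
  shows "\<bar>correlate \<rho> u x\<bar> \<le> B"
proof -
  have i: "integrable lborel (\<lambda>z. \<rho> z * u (x + z))"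
    by (rule integrable_prob_density_mult[OF _ _ \<rho> u]) measurable
  have \<rho>i: "integrable lborel \<rho>" using \<rho> by (intro integrableI_nonneg) auto
  have "\<bar>correlate \<rho> u x\<bar> \<le> (\<integral>z. B * \<rho> z \<partial>lborel)"
    unfolding correlate_eq_average[OF assms(1,2)]
  proof (rule order_trans[OF integral_abs_bound integral_mono])
    show "integrable lborel (\<lambda>z. \<bar>\<rho> z * u (x + z)\<bar>)" using i by (rule integrable_abs)
    show "integrable lborel (\<lambda>z. B * \<rho> z)" using \<rho>i by simp
    fix z
    have "\<bar>\<rho> z * u (x + z)\<bar> = \<rho> z * \<bar>u (x + z)\<bar>" using \<rho>(1)[of z] by (simp add: abs_mult)
    also have "\<dots> \<le> \<rho> z * B" using \<rho>(1) u by (intro mult_left_mono) auto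
    finally show "\<bar>\<rho> z * u (x + z)\<bar> \<le> B * \<rho> z" by (simp add: mult.commute)
  qed
  also have "\<dots> = B" using \<rho> \<rho>i by (simp add: integral_eq_nn_integral)
  finally show ?thesis .
qed

lemma correlate_in_Cc_infinity:
  fixes \<rho> u :: "'a::euclidean_space \<Rightarrow> real"
  assumes "open \<Omega>" "bounded \<Omega>" and \<rho>: "\<rho> \<in> bump_algebra c" "\<And>z. \<delta> / 2 \<le> norm z \<Longrightarrow> \<rho> z = 0"
    and "0 < \<delta>" and u: "integrable lborel u" "\<And>x. infdist x (- \<Omega>) < \<delta> \<Longrightarrow> u x = 0"
  shows "correlate \<rho> u \<in> Cc_infinity \<Omega>"
proof -
  have supp: "{x. correlate \<rho> u x \<noteq> 0} \<subseteq> {x. \<delta> / 2 \<le> infdist x (- \<Omega>)}"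
  proof
    fix x assume "x \<in> {x. correlate \<rho> u x \<noteq> 0}"
    then have "\<exists>y. \<rho> (y - x) * u y \<noteq> 0" unfolding correlate_def by (metis (mono_tags, lifting) Bochner_Integration.integral_cong integral_zero mem_Collect_eq)
    then obtain y where "\<rho> (y - x) \<noteq> 0" "u y \<noteq> 0" by auto
    then have "norm (y - x) < \<delta> / 2" "\<delta> \<le> infdist y (- \<Omega>)"
      using \<rho>(2) u(2) by (meson not_le)+
    then show "x \<in> {x. \<delta> / 2 \<le> infdist x (- \<Omega>)}"
      using infdist_triangle_abs[of y "- \<Omega>" x] by (simp add: dist_norm)
  qed
  have "closed {x. \<delta> / 2 \<le> infdist x (- \<Omega>)}"
    by (intro closed_Collect_le continuous_intros)
  then have cl: "closure {x. correlate \<rho> u x \<noteq> 0} \<subseteq> {x. \<delta> / 2 \<le> infdist x (- \<Omega>)}"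
    using supp by (rule closure_minimal[rotated])
  also have "\<dots> \<subseteq> \<Omega>"
  proof
    fix x assume "x \<in> {x. \<delta> / 2 \<le> infdist x (- \<Omega>)}"
    then have "infdist x (- \<Omega>) \<noteq> 0" using \<open>0 < \<delta>\<close> by auto
    then show "x \<in> \<Omega>" using infdist_zero[of x "- \<Omega>"] by blast
  qed
  finally have cl\<Omega>: "closure {x. correlate \<rho> u x \<noteq> 0} \<subseteq> \<Omega>" .
  then have "bounded (closure {x. correlate \<rho> u x \<noteq> 0})"
    using \<open>bounded \<Omega>\<close> bounded_subset by blast
  then have "compact (closure {x. correlate \<rho> u x \<noteq> 0})" by (simp add: compact_eq_bounded_closed)
  moreover have "C_k k (correlate \<rho> u)" for k
    using \<rho>(1) _ u(1) by (rule correlate_bump_C_k[where R = "\<delta> / 2"]) (simp add: \<rho>(2))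
  ultimately show ?thesis using cl\<Omega> by (simp add: Cc_infinity_def)
qed

text \<open>Mollify at scales tending to zero. The seminorm does not increase, and the \<open>L\<^sup>1\<close> convergence gives
  almost everywhere convergence along a subsequence, which suffices for the pairing with the integrable
  function \<open>g\<close> because the mollifications are uniformly bounded. The conclusion is stated for all
  multiples of \<open>\<phi>\<close>, since scaling is what makes the functional unbounded.\<close>
lemma smooth_approximation:
  fixes u g :: "'a::euclidean_space \<Rightarrow> real" and s :: real
  assumes \<Omega>: "open \<Omega>" "bounded \<Omega>" and "0 < s"
    and u [measurable]: "u \<in> borel_measurable borel" and u_bound: "\<And>x. \<bar>u x\<bar> \<le> B"
    and "0 < \<delta>" and u_supp: "\<And>x. infdist x (- \<Omega>) < \<delta> \<Longrightarrow> u x = 0"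
    and fin: "gagliardo s UNIV u < \<infinity>" and g: "integrable lborel g" and "0 < e"
  shows "\<exists>\<phi>. (\<forall>c. (\<lambda>x. c * \<phi> x) \<in> Cc_infinity \<Omega>) \<and> \<phi> \<in> borel_measurable borel \<and>
    gagliardo s UNIV \<phi> \<le> gagliardo s UNIV u \<and>
    \<bar>(\<integral>x. g x * \<phi> x \<partial>lborel) - (\<integral>x. g x * u x \<partial>lborel)\<bar> < e"
proof -
  have [measurable]: "g \<in> borel_measurable borel" using g by auto
  have u_out: "u x = 0" if "x \<notin> \<Omega>" for x using that \<open>0 < \<delta>\<close> by (intro u_supp) auto
  have ui: "integrable lborel u" using u \<Omega>(2) u_out u_bound by (rule integrable_bounded_support)
  define \<epsilon> where "\<epsilon> j = \<delta> / 2 / real (Suc j)" for j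
  have \<epsilon>: "0 < \<epsilon> j" "\<epsilon> j \<le> \<delta> / 2" for j using \<open>0 < \<delta>\<close> by (auto simp: \<epsilon>_def field_simps)
  define C where "C = exp 2 * 2 ^ DIM('a) / unit_ball_vol (real DIM('a))"
  have "\<forall>j. \<exists>\<rho> :: 'a \<Rightarrow> real. \<rho> \<in> bump_algebra (1 / (\<epsilon> j)\<^sup>2) \<and> (\<forall>z. 0 \<le> \<rho> z) \<and>
    (\<forall>z. \<epsilon> j \<le> norm z \<longrightarrow> \<rho> z = 0) \<and> (\<integral>\<^sup>+z. ennreal (\<rho> z) \<partial>lborel) = 1 \<and>
    (\<forall>z. z \<noteq> 0 \<longrightarrow> ennreal (\<rho> z) \<le> ennreal (C * \<epsilon> j powr s) * frac_kernel s z)"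
    unfolding C_def using mollifier_exists[OF \<epsilon>(1) \<open>0 < s\<close>] by blast
  then obtain \<rho> :: "nat \<Rightarrow> 'a \<Rightarrow> real" where \<rho>: "\<And>j. \<rho> j \<in> bump_algebra (1 / (\<epsilon> j)\<^sup>2)"
    "\<And>j z. 0 \<le> \<rho> j z" "\<And>j z. \<epsilon> j \<le> norm z \<Longrightarrow> \<rho> j z = 0" "\<And>j. (\<integral>\<^sup>+z. ennreal (\<rho> j z) \<partial>lborel) = 1"
    "\<And>j z. z \<noteq> 0 \<Longrightarrow> ennreal (\<rho> j z) \<le> ennreal (C * \<epsilon> j powr s) * frac_kernel s z"
    by metis
  have \<rho>m [measurable]: "\<rho> j \<in> borel_measurable borel" for j
    using bump_algebra_continuous[OF \<rho>(1)] by (rule borel_measurable_continuous_onI)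
  define \<phi> where "\<phi> j = correlate (\<rho> j) u" for j
  have \<phi>m [measurable]: "\<phi> j \<in> borel_measurable borel" for j unfolding \<phi>_def by measurable
  have \<phi>_cc: "(\<lambda>x. c * \<phi> j x) \<in> Cc_infinity \<Omega>" for c j
  proof -
    have "(\<lambda>x. c * \<phi> j x) = correlate (\<rho> j) (\<lambda>y. c * u y)"
      by (auto simp: \<phi>_def correlate_def mult.left_commute)
    also have "\<dots> \<in> Cc_infinity \<Omega>"
    proof (rule correlate_in_Cc_infinity[OF \<Omega> \<rho>(1) _ \<open>0 < \<delta>\<close>])
      show "\<rho> j z = 0" if "\<delta> / 2 \<le> norm z" for z
        using \<rho>(3)[of j z] \<epsilon>(2)[of j] that by linarith
    qed (use ui u_supp in auto)
    finally show ?thesis .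
  qed
  have \<phi>_bound: "\<bar>\<phi> j x\<bar> \<le> B" for j x
    unfolding \<phi>_def by (rule abs_correlate_le[OF \<rho>m u \<rho>(2,4) u_bound])
  have \<phi>_gag: "gagliardo s UNIV (\<phi> j) \<le> gagliardo s UNIV u" for j
    unfolding \<phi>_def by (rule gagliardo_correlate_le[OF \<rho>m u \<rho>(2,4) u_bound])
  have \<phi>_out: "\<phi> j x = 0" if "x \<notin> \<Omega>" for j x
  proof (rule ccontr)
    assume "\<phi> j x \<noteq> 0"
    then have "x \<in> {x. 1 * \<phi> j x \<noteq> 0}" by simp
    then have "x \<in> closure {x. 1 * \<phi> j x \<noteq> 0}" using closure_subset by (rule subsetD[rotated])
    then show False using \<phi>_cc[of 1 j] that by (auto simp: Cc_infinity_def)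
  qed
  have \<phi>i: "integrable lborel (\<phi> j)" for j
    using \<phi>m \<Omega>(2) \<phi>_out \<phi>_bound by (rule integrable_bounded_support)
  obtain G where G: "gagliardo s UNIV u = ennreal G" "0 \<le> G"
    using fin by (cases "gagliardo s UNIV u") auto
  have "0 \<le> C" by (simp add: C_def)
  have L1: "(\<integral>x. norm (\<phi> j x - u x) \<partial>lborel) \<le> C * \<epsilon> j powr s * G" for j
  proof -
    have "ennreal (\<integral>x. norm (\<phi> j x - u x) \<partial>lborel) = (\<integral>\<^sup>+x. ennreal \<bar>\<phi> j x - u x\<bar> \<partial>lborel)"
      using \<phi>i ui by (subst nn_integral_eq_integral) auto
    also have "\<dots> \<le> ennreal (C * \<epsilon> j powr s) * gagliardo s UNIV u"
      unfolding \<phi>_def by (rule correlate_L1_le[OF \<rho>m u \<rho>(2,4) u_bound \<rho>(5)])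
    also have "\<dots> = ennreal (C * \<epsilon> j powr s * G)" using \<open>0 \<le> C\<close> G by (simp add: ennreal_mult')
    finally show ?thesis using \<open>0 \<le> C\<close> G by (simp add: ennreal_le_iff)
  qed
  have "\<epsilon> \<longlonglongrightarrow> 0" unfolding \<epsilon>_def[abs_def] by (rule LIMSEQ_Suc[OF lim_const_over_n])
  then have "(\<lambda>j. \<epsilon> j powr s) \<longlonglongrightarrow> 0"
    using \<epsilon>(1) \<open>0 < s\<close> by (intro tendsto_zero_powrI[where b = s]) (auto simp: less_imp_le)
  then have "(\<lambda>j. C * \<epsilon> j powr s * G) \<longlonglongrightarrow> C * 0 * G" by (intro tendsto_intros)
  then have "(\<lambda>j. C * \<epsilon> j powr s * G) \<longlonglongrightarrow> 0" by simp
  then have "(\<lambda>j. \<integral>x. norm (\<phi> j x - u x) \<partial>lborel) \<longlonglongrightarrow> 0"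
    by (rule tendsto_sandwich[rotated 2, OF tendsto_const]) (use L1 in \<open>auto intro!: always_eventually\<close>)
  then obtain r where r: "strict_mono r" "AE x in lborel. (\<lambda>j. \<phi> (r j) x - u x) \<longlonglongrightarrow> 0"
    using tendsto_L1_AE_subseq[of lborel "\<lambda>j x. \<phi> j x - u x"] \<phi>i ui by auto
  have "(\<lambda>j. \<integral>x. g x * \<phi> (r j) x \<partial>lborel) \<longlonglongrightarrow> (\<integral>x. g x * u x \<partial>lborel)"
  proof (rule integral_dominated_convergence[where w = "\<lambda>x. B * \<bar>g x\<bar>"])
    show "integrable lborel (\<lambda>x. B * \<bar>g x\<bar>)" using g by auto
    show "AE x in lborel. (\<lambda>j. g x * \<phi> (r j) x) \<longlonglongrightarrow> g x * u x"
      using r(2) by eventually_elim (rule tendsto_mult_left, rule LIM_zero_cancel)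
    have "norm (g x * \<phi> (r j) x) \<le> B * \<bar>g x\<bar>" for j x
      using mult_right_mono[OF \<phi>_bound[of "r j" x], of "\<bar>g x\<bar>"] by (simp add: abs_mult mult.commute)
    then show "AE x in lborel. norm (g x * \<phi> (r j) x) \<le> B * \<bar>g x\<bar>" for j by simp
  qed measurable
  then obtain j where "\<bar>(\<integral>x. g x * \<phi> (r j) x \<partial>lborel) - (\<integral>x. g x * u x \<partial>lborel)\<bar> < e"
    using \<open>0 < e\<close> unfolding lim_sequentially dist_real_def by blast
  then show ?thesis using \<phi>_cc \<phi>_gag \<phi>m by blast
qed

section \<open>Borel representatives and test functions\<close>

lemma F1_cong_weight:
  fixes f g u :: "'a::euclidean_space \<Rightarrow> real"
  assumes f: "set_borel_measurable lebesgue \<Omega> f" and g: "set_borel_measurable lebesgue \<Omega> g"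
    and fg: "AE x in lebesgue. x \<in> \<Omega> \<longrightarrow> f x = g x"
    and [measurable]: "u \<in> borel_measurable lebesgue"
  shows "F1 s f \<Omega> u = F1 s g \<Omega> u"
proof -
  have m: "(\<lambda>x. indicator \<Omega> x *\<^sub>R (h x * u x)) \<in> borel_measurable lebesgue"
    if "set_borel_measurable lebesgue \<Omega> h" for h
  proof -
    have "(\<lambda>x. (indicator \<Omega> x *\<^sub>R h x) * u x) \<in> borel_measurable lebesgue"
      using that unfolding set_borel_measurable_def by measurable
    then show ?thesis by (simp add: mult.assoc)
  qed
  have "(LINT x:\<Omega>|lebesgue. f x * u x) = (LINT x:\<Omega>|lebesgue. g x * u x)"
    unfolding set_lebesgue_integral_def
  proof (rule integral_cong_AE[OF m[OF f] m[OF g]])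
    show "AE x in lebesgue. indicator \<Omega> x *\<^sub>R (f x * u x) = indicator \<Omega> x *\<^sub>R (g x * u x)"
      using fg by eventually_elim (auto simp: indicator_def)
  qed
  then show ?thesis by (simp add: F1_def)
qed

lemma cheeger_cong_weight:
  fixes f g :: "'a::euclidean_space \<Rightarrow> real"
  assumes f: "set_borel_measurable lebesgue \<Omega> f" and g: "set_borel_measurable lebesgue \<Omega> g"
    and fg: "AE x in lebesgue. x \<in> \<Omega> \<longrightarrow> f x = g x"
  shows "cheeger s f \<Omega> = cheeger s g \<Omega>"
proof -
  have vol: "weighted_volume f A = weighted_volume g A" if A: "A \<subseteq> \<Omega>" "A \<in> sets lebesgue" for A
  proof -
    have m: "(\<lambda>x. indicator A x *\<^sub>R h x) \<in> borel_measurable lebesgue"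
      if "set_borel_measurable lebesgue \<Omega> h" for h :: "'a \<Rightarrow> real"
    proof -
      have "(\<lambda>x. indicator A x * (indicator \<Omega> x *\<^sub>R h x)) \<in> borel_measurable lebesgue"
        using that A(2) unfolding set_borel_measurable_def by measurable
      also have "(\<lambda>x. indicator A x * (indicator \<Omega> x *\<^sub>R h x)) = (\<lambda>x. indicator A x *\<^sub>R h x)"
        using A(1) by (auto simp: indicator_def fun_eq_iff)
      finally show ?thesis .
    qed
    show ?thesis unfolding weighted_volume_def set_lebesgue_integral_def
    proof (rule integral_cong_AE[OF m[OF f] m[OF g]])
      show "AE x in lebesgue. indicator A x *\<^sub>R f x = indicator A x *\<^sub>R g x"
        using fg by eventually_elim (use A(1) in \<open>auto simp: indicator_def\<close>)
    qed
  qed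
  then have "{A. A \<subseteq> \<Omega> \<and> A \<in> sets lebesgue \<and> 0 < weighted_volume f A}
      = {A. A \<subseteq> \<Omega> \<and> A \<in> sets lebesgue \<and> 0 < weighted_volume g A}" by auto
  then show ?thesis unfolding cheeger_def using vol by (intro INF_cong) auto
qed

text \<open>A weight in \<open>L\<^sup>p\<close> of a bounded set is integrable. Replacing it by a nonnegative Borel function that
  vanishes outside \<open>\<Omega>\<close> changes neither the functional nor the Cheeger constant.\<close>
lemma borel_representative_of_weight:
  fixes f :: "'a::euclidean_space \<Rightarrow> real"
  assumes \<Omega>: "open \<Omega>" "bounded \<Omega>" and f0: "AE x in lebesgue. x \<in> \<Omega> \<longrightarrow> 0 \<le> f x"
    and p: "1 \<le> p" and f: "in_Lp p \<Omega> f"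
  obtains g where "integrable lborel g" "\<And>x. 0 \<le> g x" "\<And>x. x \<notin> \<Omega> \<Longrightarrow> g x = 0"
    "AE x in lebesgue. x \<in> \<Omega> \<longrightarrow> f x = g x"
proof -
  have [measurable]: "\<Omega> \<in> sets borel" using \<Omega>(1) by simp
  have fm: "(\<lambda>x. indicator \<Omega> x *\<^sub>R f x) \<in> borel_measurable lebesgue"
    and fp: "integrable lebesgue (\<lambda>x. indicator \<Omega> x *\<^sub>R (\<bar>f x\<bar> powr p))"
    using f by (auto simp: in_Lp_def set_borel_measurable_def set_integrable_def)
  have fi: "integrable lebesgue (\<lambda>x. indicator \<Omega> x *\<^sub>R f x)"
  proof (rule Bochner_Integration.integrable_bound)
    have "emeasure lebesgue \<Omega> < \<infinity>"
      using emeasure_bounded_finite[OF \<Omega>(2)] \<Omega>(1) by (simp add: emeasure_completion)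
    then have "integrable lebesgue (\<lambda>x. indicator \<Omega> x :: real)" by simp
    then show "integrable lebesgue (\<lambda>x. indicator \<Omega> x + indicator \<Omega> x *\<^sub>R (\<bar>f x\<bar> powr p))"
      using fp by (rule Bochner_Integration.integrable_add)
    \<comment> \<open>The constant \<open>1\<close> is integrable over the bounded set \<open>\<Omega>\<close>.\<close>
    have "\<bar>f x\<bar> \<le> 1 + \<bar>f x\<bar> powr p" for x
    proof (cases "\<bar>f x\<bar> \<le> 1")
      case True then show ?thesis by (simp add: add_increasing2)
    next
      case False
      then have "\<bar>f x\<bar> powr 1 \<le> \<bar>f x\<bar> powr p" using p by (intro powr_mono) auto
      then show ?thesis using False by simp
    qed
    then show "AE x in lebesgue. norm (indicator \<Omega> x *\<^sub>R f x) \<le> norm (indicator \<Omega> x + indicator \<Omega> x *\<^sub>R (\<bar>f x\<bar> powr p))"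
      by (auto simp: indicator_def)
  qed (rule fm)
  obtain g0 where g0 [measurable]: "g0 \<in> borel_measurable lborel"
    and g0_eq: "AE x in lborel. indicator \<Omega> x *\<^sub>R f x = g0 x"
    using completion_ex_borel_measurable_real[OF fm] by blast
  define g where "g = (\<lambda>x. indicator \<Omega> x * max 0 (g0 x))"
  have eq: "AE x in lebesgue. x \<in> \<Omega> \<longrightarrow> f x = g x"
    using f0 AE_completion[OF g0_eq] by eventually_elim (auto simp: g_def)
  have gm [measurable]: "g \<in> borel_measurable lborel" unfolding g_def by measurable
  have "integrable lebesgue g"
  proof -
    have "AE x in lebesgue. indicator \<Omega> x *\<^sub>R f x = g x"
      using eq by eventually_elim (auto simp: g_def indicator_def)
    then show ?thesis
      using fi fm by (subst integrable_cong_AE[symmetric]) (auto intro: measurable_completion gm)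
  qed
  then have "integrable lborel g" using integrable_completion[of g lborel] gm by simp
  then show thesis by (intro that[of g] eq) (auto simp: g_def)
qed

text \<open>The constant sequence approximates a test function.\<close>
lemma Cc_infinity_subset_Ws1_0:
  fixes \<phi> :: "'a::euclidean_space \<Rightarrow> real"
  assumes "\<phi> \<in> Cc_infinity \<Omega>"
  shows "\<phi> \<in> Ws1_0 s \<Omega>"
proof -
  have "continuous_on UNIV \<phi>" using assms by (auto simp: Cc_infinity_def dest: spec[of _ 0])
  then have "\<phi> \<in> borel_measurable borel" by (rule borel_measurable_continuous_onI)
  then have "\<phi> \<in> borel_measurable lebesgue" by (simp add: measurable_completion)
  moreover have "\<phi> x = 0" if "x \<notin> \<Omega>" for x
    using assms that closure_subset[of "{x. \<phi> x \<noteq> 0}"] by (auto simp: Cc_infinity_def)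
  moreover have "(\<lambda>k::nat. Ws1_norm s \<Omega> (\<lambda>x. \<phi> x - \<phi> x)) \<longlonglongrightarrow> 0"
    by (simp add: Ws1_norm_def gagliardo_def)
  ultimately show ?thesis unfolding Ws1_0_def using assms by (auto intro!: exI[of _ "\<lambda>k. \<phi>"])
qed

lemma zero_in_Cc_infinity: "(\<lambda>x. 0) \<in> Cc_infinity \<Omega>"
proof -
  have "C_k k (\<lambda>x::'a::euclidean_space. 0)" for k
    by (rule C_k_if_closed_under_partial_derivatives[of "{\<lambda>x. 0}"]) (auto intro!: exI[of _ "\<lambda>x h. 0"])
  then show ?thesis by (simp add: Cc_infinity_def)
qed

lemma F1_lborel:
  fixes u g :: "'a::euclidean_space \<Rightarrow> real"
  assumes [measurable]: "g \<in> borel_measurable borel" "u \<in> borel_measurable lebesgue" "v \<in> borel_measurable borel"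
    and "\<And>x. x \<notin> \<Omega> \<Longrightarrow> g x = 0" and uv: "AE x in lborel. u x = v x"
  shows "F1 s g \<Omega> u = enn2ereal (1/2 * gagliardo s UNIV v) - ereal (\<integral>x. g x * v x \<partial>lborel)"
proof -
  have "(LINT x:\<Omega>|lebesgue. g x * u x) = (\<integral>x. g x * u x \<partial>lebesgue)"
    unfolding set_lebesgue_integral_def
    by (intro Bochner_Integration.integral_cong) (auto simp: indicator_def assms(4))
  also have "\<dots> = (\<integral>x. g x * v x \<partial>lebesgue)"
  proof (rule integral_cong_AE)
    show "(\<lambda>x. g x * u x) \<in> borel_measurable lebesgue" "(\<lambda>x. g x * v x) \<in> borel_measurable lebesgue"
      using assms(1-3) by (auto intro!: borel_measurable_times intro: measurable_completion)
    show "AE x in lebesgue. g x * u x = g x * v x"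
      using AE_completion[OF uv] by eventually_elim simp
  qed
  also have "\<dots> = (\<integral>x. g x * v x \<partial>lborel)" by (rule integral_completion) measurable
  finally show ?thesis using gagliardo_cong_AE[OF uv] by (simp add: F1_def)
qed

lemma borel_representative_Ws1_0:
  fixes u :: "'a::euclidean_space \<Rightarrow> real"
  assumes "open \<Omega>" "u \<in> Ws1_0 s \<Omega>"
  obtains v where "v \<in> borel_measurable borel" "\<And>x. x \<notin> \<Omega> \<Longrightarrow> v x = 0" "AE x in lborel. u x = v x"
proof -
  have u: "u \<in> borel_measurable lebesgue" "\<And>x. x \<notin> \<Omega> \<Longrightarrow> u x = 0"
    using assms(2) by (auto simp: Ws1_0_def)
  obtain v0 where v0 [measurable]: "v0 \<in> borel_measurable lborel" and eq: "AE x in lborel. u x = v0 x"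
    using completion_ex_borel_measurable_real[OF u(1)] by blast
  have [measurable]: "\<Omega> \<in> sets borel" using assms(1) by simp
  show thesis
  proof (rule that[of "\<lambda>x. indicator \<Omega> x * v0 x"])
    have "(\<lambda>x. indicator \<Omega> x * v0 x) \<in> borel_measurable lborel" by measurable
    then show "(\<lambda>x. indicator \<Omega> x * v0 x) \<in> borel_measurable borel" by simp
    show "AE x in lborel. u x = indicator \<Omega> x * v0 x"
      using eq by eventually_elim (use u(2) in \<open>auto simp: indicator_def\<close>)
  qed auto
qed

section \<open>Minimality and uniqueness of the null function\<close>

lemma ennreal_integral_le_nn_integral_abs:
  fixes h :: "'a \<Rightarrow> real"
  shows "ennreal (integral\<^sup>L M h) \<le> (\<integral>\<^sup>+x. ennreal \<bar>h x\<bar> \<partial>M)"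
proof (cases "integrable M h")
  case True
  have "ennreal (integral\<^sup>L M h) \<le> ennreal (norm (integral\<^sup>L M h))" by (intro ennreal_leI) simp
  also have "\<dots> \<le> (\<integral>\<^sup>+x. ennreal (norm (h x)) \<partial>M)" using True by (rule integral_norm_bound_ennreal)
  finally show ?thesis by simp
qed (simp add: not_integrable_integral_eq)

lemma ereal_le_enn2ereal_ennreal: "ereal r \<le> enn2ereal (ennreal r)"
  by (cases "0 \<le> r") (auto simp: ennreal_neg zero_ennreal.rep_eq)

text \<open>By the functional Cheeger inequality the weighted integral of \<open>\<bar>u\<bar>\<close> is at most half the seminorm as soon
  as the Cheeger constant is at least one. The inequality between extended numbers also covers functions
  of infinite seminorm.\<close>
lemma F1_nonneg:
  fixes g :: "'a::euclidean_space \<Rightarrow> real"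
  assumes \<Omega>: "open \<Omega>" and g: "integrable lborel g" "\<And>x. 0 \<le> g x" "\<And>x. x \<notin> \<Omega> \<Longrightarrow> g x = 0"
    and h: "1 \<le> cheeger s g \<Omega>" and u: "u \<in> Ws1_0 s \<Omega>"
  shows "0 \<le> F1 s g \<Omega> u"
proof -
  have [measurable]: "g \<in> borel_measurable borel" using g(1) by auto
  obtain v where v [measurable]: "v \<in> borel_measurable borel" and v0: "\<And>x. x \<notin> \<Omega> \<Longrightarrow> v x = 0"
    and uv: "AE x in lborel. u x = v x"
    using borel_representative_Ws1_0[OF \<Omega> u] by blast
  have um: "u \<in> borel_measurable lebesgue" using u by (simp add: Ws1_0_def)
  have "ennreal (\<integral>x. g x * v x \<partial>lborel) \<le> (\<integral>\<^sup>+x. ennreal \<bar>g x * v x\<bar> \<partial>lborel)"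
    by (rule ennreal_integral_le_nn_integral_abs)
  also have "\<dots> = 1 * (\<integral>\<^sup>+x. ennreal (g x * \<bar>v x\<bar>) \<partial>lborel)" using g(2) by (simp add: abs_mult)
  also have "\<dots> \<le> cheeger s g \<Omega> * (\<integral>\<^sup>+x. ennreal (g x * \<bar>v x\<bar>) \<partial>lborel)"
    using h by (rule mult_right_mono) simp
  also have "\<dots> \<le> 1/2 * gagliardo s UNIV v"
    by (rule functional_cheeger_inequality[OF v v0 g(1,2)])
  finally have "enn2ereal (ennreal (\<integral>x. g x * v x \<partial>lborel)) \<le> enn2ereal (1/2 * gagliardo s UNIV v)"
    by (simp add: less_eq_ennreal.rep_eq)
  then have "ereal (\<integral>x. g x * v x \<partial>lborel) \<le> enn2ereal (1/2 * gagliardo s UNIV v)"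
    by (rule order_trans[OF ereal_le_enn2ereal_ennreal])
  moreover have "F1 s g \<Omega> u = enn2ereal (1/2 * gagliardo s UNIV v) - ereal (\<integral>x. g x * v x \<partial>lborel)"
    by (rule F1_lborel[OF \<open>g \<in> borel_measurable borel\<close> um v g(3) uv])
  ultimately show ?thesis by (simp add: ereal_diff_positive)
qed

lemma zero_in_Ws1_0: "(\<lambda>x. 0) \<in> Ws1_0 s \<Omega>"
  by (rule Cc_infinity_subset_Ws1_0[OF zero_in_Cc_infinity])

lemma F1_zero: "F1 s g \<Omega> (\<lambda>x. 0) = 0"
  by (simp add: F1_def gagliardo_def zero_ennreal.rep_eq)

lemma zero_is_minimizer:
  fixes g :: "'a::euclidean_space \<Rightarrow> real"
  assumes "open \<Omega>" and "integrable lborel g" "\<And>x. 0 \<le> g x" "\<And>x. x \<notin> \<Omega> \<Longrightarrow> g x = 0"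
    and "1 \<le> cheeger s g \<Omega>"
  shows "is_minimizer s g \<Omega> (\<lambda>x. 0)"
  unfolding is_minimizer_def F1_zero using F1_nonneg[OF assms] zero_in_Ws1_0 by blast

text \<open>Let \<open>p\<close> be the weighted integral of \<open>\<bar>u\<bar>\<close>, \<open>G\<close> half the seminorm and \<open>h\<close> the Cheeger constant. A minimizer has
  energy at most zero, so that \<open>G\<close> is finite and \<open>G \<le> p\<close>, while \<open>h * p \<le> G\<close>. With
  \<open>h > 1\<close> this leaves only \<open>p = 0\<close>, and then \<open>G = 0\<close>.\<close>
lemma minimizer_AE_zero:
  fixes g :: "'a::euclidean_space \<Rightarrow> real"
  assumes \<Omega>: "open \<Omega>" "bounded \<Omega>"
    and g: "integrable lborel g" "\<And>x. 0 \<le> g x" "\<And>x. x \<notin> \<Omega> \<Longrightarrow> g x = 0"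
    and h: "1 < cheeger s g \<Omega>" and u: "is_minimizer s g \<Omega> u"
  shows "AE x in lborel. u x = 0"
proof -
  have [measurable]: "g \<in> borel_measurable borel" using g(1) by auto
  have uW: "u \<in> Ws1_0 s \<Omega>" and "F1 s g \<Omega> u \<le> F1 s g \<Omega> (\<lambda>x. 0)"
    using u zero_in_Ws1_0 by (auto simp: is_minimizer_def)
  then have F: "F1 s g \<Omega> u \<le> 0" by (simp add: F1_zero)
  obtain v where v [measurable]: "v \<in> borel_measurable borel" and v0: "\<And>x. x \<notin> \<Omega> \<Longrightarrow> v x = 0"
    and uv: "AE x in lborel. u x = v x"
    using borel_representative_Ws1_0[OF \<Omega>(1) uW] by blast
  have um: "u \<in> borel_measurable lebesgue" using uW by (simp add: Ws1_0_def)
  define G where "G = 1/2 * gagliardo s UNIV v"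
  define p where "p = (\<integral>\<^sup>+x. ennreal (g x * \<bar>v x\<bar>) \<partial>lborel)"
  define I where "I = (\<integral>x. g x * v x \<partial>lborel)"
  have hp: "cheeger s g \<Omega> * p \<le> G"
    unfolding p_def G_def by (rule functional_cheeger_inequality[OF v v0 g(1,2)])
  have Ip: "ennreal I \<le> p"
    using ennreal_integral_le_nn_integral_abs[of lborel "\<lambda>x. g x * v x"] g(2)
    by (simp add: I_def p_def abs_mult)
  have "F1 s g \<Omega> u = enn2ereal G - ereal I"
    unfolding G_def I_def by (rule F1_lborel[OF \<open>g \<in> borel_measurable borel\<close> um v g(3) uv])
  with F have "enn2ereal G - ereal I \<le> 0" by simp
  then have "enn2ereal G \<le> ereal I" by (cases "enn2ereal G") auto
  then have "enn2ereal G \<le> enn2ereal (ennreal I)"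
    using ereal_le_enn2ereal_ennreal by (rule order_trans)
  then have GI: "G \<le> ennreal I" by (simp add: less_eq_ennreal.rep_eq)
  have "p = 0"
  proof (rule ccontr)
    assume "p \<noteq> 0"
    have "1 * p \<le> cheeger s g \<Omega> * p" using h by (intro mult_right_mono) auto
    then have "p \<le> ennreal I" using hp GI by simp
    then have "p < top" using ennreal_less_top le_less_trans by blast
    then have "1 * p < cheeger s g \<Omega> * p"
      using h \<open>p \<noteq> 0\<close> by (intro ennreal_mult_strict_right_mono) (auto simp: zero_less_iff_neq_zero)
    also have "\<dots> \<le> p" using hp GI Ip by (meson order_trans)
    finally show False by simp
  qed
  then have "G = 0" using GI Ip by simp
  then have "gagliardo s UNIV v = 0" by (simp add: G_def)
  then have "AE x in lborel. v x = 0"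
    by (intro gagliardo_zero_imp_AE_zero[OF v \<Omega>(2)]) (auto intro: v0)
  with uv show ?thesis by eventually_elim simp
qed

section \<open>Unboundedness below a Cheeger constant of one\<close>

text \<open>Some set has a Cheeger quotient below one, because the infimum is below one. What has to be arranged
  is a Borel version of that set that still lies inside \<open>\<Omega>\<close>.\<close>
lemma negative_competitor_set:
  fixes g :: "'a::euclidean_space \<Rightarrow> real"
  assumes \<Omega>: "open \<Omega>" and g: "integrable lborel g" and h: "cheeger s g \<Omega> < 1"
  obtains A where "A \<in> sets borel" "A \<subseteq> \<Omega>"
    "1/2 * gagliardo s UNIV (indicator A) < ennreal (\<integral>x. g x * indicator A x \<partial>lborel)"
proof -
  have [measurable]: "g \<in> borel_measurable borel" "\<Omega> \<in> sets borel" using g \<Omega> by auto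
  obtain A where A: "A \<subseteq> \<Omega>" "A \<in> sets lebesgue" "0 < weighted_volume g A"
    and q: "Per s A / ennreal (weighted_volume g A) < 1"
    using h unfolding cheeger_def INF_less_iff by auto
  have lt: "Per s A < ennreal (weighted_volume g A)"
  proof (rule ccontr)
    assume "\<not> ?thesis"
    then have "ennreal (weighted_volume g A) / ennreal (weighted_volume g A) \<le> Per s A / ennreal (weighted_volume g A)"
      by (intro divide_right_mono_ennreal) simp
    then show False using q A(3) by (simp add: divide_ennreal)
  qed
  have "(indicator A :: 'a \<Rightarrow> real) \<in> borel_measurable lebesgue" using A(2) by simp
  then obtain w :: "'a \<Rightarrow> real" where [measurable]: "w \<in> borel_measurable lborel"
    and w: "AE x in lborel. indicator A x = w x"
    using completion_ex_borel_measurable_real by blast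
  \<comment> \<open>The Borel function \<open>w\<close> need not be an indicator everywhere; intersecting with the open set \<open>\<Omega>\<close> keeps
    the set Borel and inside \<open>\<Omega>\<close>.\<close>
  define B where "B = {x \<in> \<Omega>. w x = 1}"
  have "{x \<in> space lborel. x \<in> \<Omega> \<and> w x = 1} \<in> sets lborel" by measurable
  then have B [measurable]: "B \<in> sets borel" by (simp add: B_def)
  have AB: "AE x in lborel. (indicator A x :: real) = indicator B x"
    using w
  proof eventually_elim
    case (elim x)
    then show ?case using A(1) by (cases "x \<in> A") (auto simp: B_def)
  qed
  have "weighted_volume g A = (\<integral>x. g x * indicator B x \<partial>lebesgue)"
    unfolding weighted_volume_def set_lebesgue_integral_def
  proof (rule integral_cong_AE)
    have "g \<in> borel_measurable lebesgue" by (rule measurable_completion) simp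
    then show "(\<lambda>x. indicator A x *\<^sub>R g x) \<in> borel_measurable lebesgue"
      using A(2) by measurable
    show "(\<lambda>x. g x * indicator B x) \<in> borel_measurable lebesgue"
      by (rule measurable_completion) measurable
    show "AE x in lebesgue. indicator A x *\<^sub>R g x = g x * indicator B x"
      using AE_completion[OF AB] by eventually_elim simp
  qed
  also have "\<dots> = (\<integral>x. g x * indicator B x \<partial>lborel)" by (rule integral_completion) measurable
  finally have "1/2 * gagliardo s UNIV (indicator B) < ennreal (\<integral>x. g x * indicator B x \<partial>lborel)"
    using lt gagliardo_cong_AE[OF AB] by (simp add: Per_def)
  then show thesis using B by (intro that[of B]) (auto simp: B_def)
qed

text \<open>The strict inequality for the set leaves room for two approximations: cutting its indicator off near
  the boundary, and then mollifying at a scale below the distance of the cut-off function to the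
  complement.\<close>
lemma negative_smooth_competitor:
  fixes g :: "'a::euclidean_space \<Rightarrow> real"
  assumes s: "0 < s" "s < 1" and \<Omega>: "open \<Omega>" "bounded \<Omega>" "lipschitz_boundary \<Omega>"
    and g: "integrable lborel g" and h: "cheeger s g \<Omega> < 1"
  obtains \<phi> where "\<And>c. (\<lambda>x. c * \<phi> x) \<in> Cc_infinity \<Omega>" "\<phi> \<in> borel_measurable borel"
    "1/2 * gagliardo s UNIV \<phi> < ennreal (\<integral>x. g x * \<phi> x \<partial>lborel)"
proof -
  have [measurable]: "g \<in> borel_measurable borel" using g by auto
  obtain A where A [measurable]: "A \<in> sets borel" and "A \<subseteq> \<Omega>"
    and lt: "1/2 * gagliardo s UNIV (indicator A) < ennreal (\<integral>x. g x * indicator A x \<partial>lborel)"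
    using negative_competitor_set[OF \<Omega>(1) g h] by blast
  have "1/2 * gagliardo s UNIV (indicator A) < top" using lt ennreal_less_top less_trans by blast
  then have fin: "gagliardo s UNIV (indicator A) < \<infinity>"
    by (auto simp: ennreal_mult_less_top)
  define u where "u k x = cutoff \<Omega> k x * indicator A x" for k x
  have um [measurable]: "u k \<in> borel_measurable borel" for k unfolding u_def[abs_def] by measurable
  define E where "E k = (\<integral>\<^sup>+y. indicator A y * (\<integral>\<^sup>+x. indicator A x *
      ennreal \<bar>cutoff \<Omega> k x - cutoff \<Omega> k y\<bar> * frac_kernel s (x - y) \<partial>lborel) \<partial>lborel)" for k
  have E: "E \<longlonglongrightarrow> 0"
    unfolding E_def[abs_def] by (rule cutoff_error_tendsto_0[OF \<Omega> s A \<open>A \<subseteq> \<Omega>\<close> fin])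
  have uE: "gagliardo s UNIV (u k) \<le> gagliardo s UNIV (indicator A) + E k" for k
    unfolding u_def[abs_def] E_def
    by (rule gagliardo_cutoff_le[OF A cutoff_measurable cutoff_bounds])
  have lim: "(\<lambda>k. \<integral>x. g x * u k x \<partial>lborel) \<longlonglongrightarrow> (\<integral>x. g x * indicator A x \<partial>lborel)"
  proof (rule integral_dominated_convergence[where w = "\<lambda>x. \<bar>g x\<bar>"])
    show "integrable lborel (\<lambda>x. \<bar>g x\<bar>)" using g by auto
    show "AE x in lborel. norm (g x * u k x) \<le> \<bar>g x\<bar>" for k
    proof (rule AE_I2)
      fix x
      have "\<bar>u k x\<bar> \<le> 1" using cutoff_bounds[of \<Omega> k x] by (auto simp: u_def indicator_def)
      then have "\<bar>g x\<bar> * \<bar>u k x\<bar> \<le> \<bar>g x\<bar> * 1" by (rule mult_left_mono) simp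
      then show "norm (g x * u k x) \<le> \<bar>g x\<bar>" by (simp add: abs_mult)
    qed
    show "AE x in lborel. (\<lambda>k. g x * u k x) \<longlonglongrightarrow> g x * indicator A x"
    proof (rule AE_I2)
      fix x
      show "(\<lambda>k. g x * u k x) \<longlonglongrightarrow> g x * indicator A x"
      proof (cases "x \<in> A")
        case True
        then obtain q where "0 < infdist x (- \<Omega>)"
          using nearest_point_in_frontier[OF \<Omega>(1,2), of x] \<open>A \<subseteq> \<Omega>\<close> by blast
        then have "\<forall>\<^sub>F k in sequentially. g x * u k x = g x * indicator A x"
          using cutoff_eventually_one by (auto elim!: eventually_mono simp: u_def)
        then show ?thesis by (rule tendsto_eventually)
      qed (simp add: u_def)
    qed
  qed measurable
  \<comment> \<open>A level strictly between perimeter and weighted volume; for large \<open>k\<close> it still separates the two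
    quantities of the cut-off functions.\<close>
  obtain m where m: "1/2 * gagliardo s UNIV (indicator A) < m" "m < ennreal (\<integral>x. g x * indicator A x \<partial>lborel)"
    using dense[OF lt] by blast
  have "(\<lambda>k. 1/2 * (gagliardo s UNIV (indicator A) + E k)) \<longlonglongrightarrow> 1/2 * (gagliardo s UNIV (indicator A) + 0)"
    by (intro ennreal_tendsto_cmult tendsto_add tendsto_const E) (simp add: ennreal_divide_eq_top_iff less_top[symmetric])
  then have "\<forall>\<^sub>F k in sequentially. 1/2 * (gagliardo s UNIV (indicator A) + E k) < m"
    using m(1) by (intro order_tendstoD(2)) auto
  moreover have "(\<lambda>k. ennreal (\<integral>x. g x * u k x \<partial>lborel)) \<longlonglongrightarrow> ennreal (\<integral>x. g x * indicator A x \<partial>lborel)"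
    using lim by (rule tendsto_ennrealI)
  then have "\<forall>\<^sub>F k in sequentially. m < ennreal (\<integral>x. g x * u k x \<partial>lborel)"
    using m(2) by (rule order_tendstoD(1))
  moreover have "\<forall>\<^sub>F k::nat in sequentially. 0 < k" by (rule eventually_gt_at_top)
  ultimately have "\<forall>\<^sub>F k in sequentially. 1/2 * (gagliardo s UNIV (indicator A) + E k) < m
      \<and> m < ennreal (\<integral>x. g x * u k x \<partial>lborel) \<and> 0 < k" by eventually_elim simp
  then obtain k where k: "1/2 * (gagliardo s UNIV (indicator A) + E k) < m"
      "m < ennreal (\<integral>x. g x * u k x \<partial>lborel)" "0 < k"
    using eventually_happens trivial_limit_sequentially by blast
  define b where "b = (\<integral>x. g x * u k x \<partial>lborel)"
  have "1/2 * gagliardo s UNIV (u k) \<le> 1/2 * (gagliardo s UNIV (indicator A) + E k)"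
    using uE by (intro mult_left_mono) auto
  then have Gu: "1/2 * gagliardo s UNIV (u k) < ennreal b" using k by (auto simp: b_def)
  then obtain a where a: "1/2 * gagliardo s UNIV (u k) = ennreal a" "0 \<le> a"
    by (cases "1/2 * gagliardo s UNIV (u k)") auto
  have "a < b" using Gu a by (simp add: ennreal_less_iff)
  have ufin: "gagliardo s UNIV (u k) < \<infinity>"
  proof -
    have "1/2 * gagliardo s UNIV (u k) < top" using a by simp
    then show ?thesis by (auto simp: ennreal_mult_less_top)
  qed
  have supp: "u k x = 0" if "infdist x (- \<Omega>) < 1 / real k" for x
    using that \<open>0 < k\<close> by (simp add: u_def cutoff_def field_simps)
  have ub: "\<bar>u k x\<bar> \<le> 1" for x using cutoff_bounds[of \<Omega> k x] by (auto simp: u_def indicator_def)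
  have "0 < 1 / real k" "0 < b - a" using \<open>0 < k\<close> \<open>a < b\<close> by auto
  then have "\<exists>\<phi>. (\<forall>c. (\<lambda>x. c * \<phi> x) \<in> Cc_infinity \<Omega>) \<and> \<phi> \<in> borel_measurable borel \<and>
      gagliardo s UNIV \<phi> \<le> gagliardo s UNIV (u k) \<and>
      \<bar>(\<integral>x. g x * \<phi> x \<partial>lborel) - (\<integral>x. g x * u k x \<partial>lborel)\<bar> < b - a"
    by (intro smooth_approximation[OF \<Omega>(1,2) s(1) um ub _ _ ufin g, of "1 / real k"] supp)
  then obtain \<phi> where \<phi>: "\<And>c. (\<lambda>x. c * \<phi> x) \<in> Cc_infinity \<Omega>" "\<phi> \<in> borel_measurable borel"
      "gagliardo s UNIV \<phi> \<le> gagliardo s UNIV (u k)" "\<bar>(\<integral>x. g x * \<phi> x \<partial>lborel) - b\<bar> < b - a"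
    unfolding b_def by blast
  have "1/2 * gagliardo s UNIV \<phi> \<le> 1/2 * gagliardo s UNIV (u k)" using \<phi>(3) by (intro mult_left_mono) auto
  also have "\<dots> = ennreal a" by fact
  also have "\<dots> < ennreal (\<integral>x. g x * \<phi> x \<partial>lborel)" using \<phi>(4) a(2) by (simp add: ennreal_less_iff)
  finally show thesis using that \<phi>(1,2) by blast
qed

text \<open>The functional is positively homogeneous of degree one, so one competitor of negative energy suffices.\<close>
lemma F1_unbounded_below:
  fixes g :: "'a::euclidean_space \<Rightarrow> real"
  assumes s: "0 < s" "s < 1" and \<Omega>: "open \<Omega>" "bounded \<Omega>" "lipschitz_boundary \<Omega>"
    and g: "integrable lborel g" "\<And>x. x \<notin> \<Omega> \<Longrightarrow> g x = 0" and h: "cheeger s g \<Omega> < 1"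
  shows "(INF u\<in>Ws1_0 s \<Omega>. F1 s g \<Omega> u) = -\<infinity>"
proof -
  have gm [measurable]: "g \<in> borel_measurable borel" using g by auto
  obtain \<phi> where \<phi>: "\<And>c. (\<lambda>x. c * \<phi> x) \<in> Cc_infinity \<Omega>" and \<phi>m [measurable]: "\<phi> \<in> borel_measurable borel"
    and lt: "1/2 * gagliardo s UNIV \<phi> < ennreal (\<integral>x. g x * \<phi> x \<partial>lborel)"
    using negative_smooth_competitor[OF s \<Omega> g(1) h] by blast
  define b where "b = (\<integral>x. g x * \<phi> x \<partial>lborel)"
  obtain a where a: "1/2 * gagliardo s UNIV \<phi> = ennreal a" "0 \<le> a"
    using lt by (cases "1/2 * gagliardo s UNIV \<phi>") auto
  have "a < b" using lt a by (simp add: b_def ennreal_less_iff)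
  have W: "(\<lambda>x. c * \<phi> x) \<in> Ws1_0 s \<Omega>" for c using \<phi> by (rule Cc_infinity_subset_Ws1_0)
  have F: "F1 s g \<Omega> (\<lambda>x. c * \<phi> x) = ereal (c * (a - b))" if "0 \<le> c" for c
  proof -
    have "1/2 * gagliardo s UNIV (\<lambda>x. c * \<phi> x) = ennreal \<bar>c\<bar> * (1/2 * gagliardo s UNIV \<phi>)"
      by (simp add: gagliardo_cmult mult.left_commute)
    also have "\<dots> = ennreal (c * a)" using that a by (simp add: ennreal_mult'[symmetric])
    finally have G: "1/2 * gagliardo s UNIV (\<lambda>x. c * \<phi> x) = ennreal (c * a)" .
    have m: "(\<lambda>x. c * \<phi> x) \<in> borel_measurable borel" by measurable
    have "(\<integral>x. g x * (c * \<phi> x) \<partial>lborel) = (\<integral>x. c * (g x * \<phi> x) \<partial>lborel)"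
      by (intro Bochner_Integration.integral_cong) auto
    then have I: "(\<integral>x. g x * (c * \<phi> x) \<partial>lborel) = c * b" by (simp add: b_def)
    have "F1 s g \<Omega> (\<lambda>x. c * \<phi> x) = enn2ereal (1/2 * gagliardo s UNIV (\<lambda>x. c * \<phi> x))
        - ereal (\<integral>x. g x * (c * \<phi> x) \<partial>lborel)"
      using W[of c] by (intro F1_lborel gm m g(2)) (auto simp: Ws1_0_def)
    then have "F1 s g \<Omega> (\<lambda>x. c * \<phi> x) = enn2ereal (ennreal (c * a)) - ereal (c * b)"
      unfolding G I .
    then show ?thesis using that a by (simp add: right_diff_distrib)
  qed
  have "(INF u\<in>Ws1_0 s \<Omega>. F1 s g \<Omega> u) \<le> ereal B" for B
  proof -
    define c where "c = \<bar>B\<bar> / (b - a)"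
    have "0 \<le> c" using \<open>a < b\<close> by (simp add: c_def)
    have "c * (a - b) = - (c * (b - a))" by (simp add: algebra_simps)
    also have "\<dots> = - \<bar>B\<bar>" using \<open>a < b\<close> by (simp add: c_def)
    finally have "F1 s g \<Omega> (\<lambda>x. c * \<phi> x) \<le> ereal B" using F[OF \<open>0 \<le> c\<close>] by simp
    then show ?thesis using W[of c] by (meson INF_lower2)
  qed
  then show ?thesis by (intro ereal_bot) auto
qed

theorem theorem4p7:
  fixes \<Omega> :: "'a::euclidean_space set" and f :: "'a \<Rightarrow> real" and s \<sigma> r\<^sub>o :: real and x\<^sub>o :: 'a
  assumes "0 < s" and "s < 1"
    and "open \<Omega>" and "bounded \<Omega>" and "lipschitz_boundary \<Omega>"
    and "AE x in lebesgue. x \<in> \<Omega> \<longrightarrow> 0 \<le> f x"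
    and "0 < \<sigma>" and "\<sigma> < s" and "in_Lp (real DIM('a) / \<sigma>) \<Omega> f"
    and "0 < r\<^sub>o" and "x\<^sub>o \<in> \<Omega>" and "ball x\<^sub>o r\<^sub>o \<subseteq> \<Omega>"
    and "0 < (LINT x:ball x\<^sub>o r\<^sub>o|lebesgue. f x)"
  shows "(1 < cheeger s f \<Omega> \<longrightarrow>
            is_minimizer s f \<Omega> (\<lambda>x. 0) \<and>
            (\<forall>u. is_minimizer s f \<Omega> u \<longrightarrow> (AE x in lebesgue. u x = 0))) \<and>
         (cheeger s f \<Omega> = 1 \<longrightarrow> (\<exists>u. is_minimizer s f \<Omega> u \<and> (\<forall>x. 0 \<le> u x))) \<and>
         (cheeger s f \<Omega> < 1 \<longrightarrow> (INF u\<in>Ws1_0 s \<Omega>. F1 s f \<Omega> u) = -\<infinity>)"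
proof -
  have "1 \<le> real DIM('a)" using DIM_positive[where 'a = 'a] by linarith
  then have "\<sigma> \<le> real DIM('a)" using assms(2,8) by linarith
  then have p: "1 \<le> real DIM('a) / \<sigma>" using assms(7) by simp
  obtain g where g: "integrable lborel g" "\<And>x. 0 \<le> g x" "\<And>x. x \<notin> \<Omega> \<Longrightarrow> g x = 0"
    and fg: "AE x in lebesgue. x \<in> \<Omega> \<longrightarrow> f x = g x"
    using borel_representative_of_weight[OF assms(3,4,6) p assms(9)] by blast
  have fm: "set_borel_measurable lebesgue \<Omega> f" using assms(9) by (simp add: in_Lp_def)
  have gm: "set_borel_measurable lebesgue \<Omega> g"
  proof -
    have "(\<lambda>x. indicator \<Omega> x *\<^sub>R g x) = g" using g(3) by (auto simp: indicator_def fun_eq_iff)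
    moreover have "g \<in> borel_measurable lebesgue"
      using borel_measurable_integrable[OF g(1)] by (rule measurable_completion)
    ultimately show ?thesis by (simp add: set_borel_measurable_def)
  qed
  have F: "F1 s f \<Omega> u = F1 s g \<Omega> u" if "u \<in> Ws1_0 s \<Omega>" for u
    using that by (intro F1_cong_weight[OF fm gm fg]) (simp add: Ws1_0_def)
  have min: "is_minimizer s f \<Omega> u = is_minimizer s g \<Omega> u" for u
    unfolding is_minimizer_def using F by auto
  have ch: "cheeger s f \<Omega> = cheeger s g \<Omega>" by (rule cheeger_cong_weight[OF fm gm fg])
  have "(INF u\<in>Ws1_0 s \<Omega>. F1 s f \<Omega> u) = (INF u\<in>Ws1_0 s \<Omega>. F1 s g \<Omega> u)"
    using F by (intro INF_cong) auto
  moreover have "is_minimizer s g \<Omega> (\<lambda>x. 0)" if "1 \<le> cheeger s g \<Omega>"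
    by (rule zero_is_minimizer[OF assms(3) g that])
  moreover have "AE x in lebesgue. u x = 0" if "1 < cheeger s g \<Omega>" "is_minimizer s g \<Omega> u" for u
    using minimizer_AE_zero[OF assms(3,4) g that] by (rule AE_completion)
  moreover have "(INF u\<in>Ws1_0 s \<Omega>. F1 s g \<Omega> u) = -\<infinity>" if "cheeger s g \<Omega> < 1"
    by (rule F1_unbounded_below[OF assms(1-5) g(1,3) that])
  ultimately show ?thesis unfolding min ch by (auto intro!: exI[of _ "\<lambda>x. 0"])
qed

end
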